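(* Let $\mathfrak N_K$ be the set of all $K$-user discrete memoryless broadcast channels, and for $\mathcal N\in\mathfrak N_K$ let $C_\Sigma^{\mathrm{NS}}(\mathcal N)$ and $C_\Sigma(\mathcal N)$ be its sum-capacity with and without NS-assistance. Then $$\sup_{\mathcal N\in\mathfrak N_K}\frac{C_\Sigma^{\mathrm{NS}}(\mathcal N)}{C_\Sigma(\mathcal N)}=K.$$
   Context: Coding framework for a discrete memoryless $K$-user BC $\mathcal N(y_1,\dots,y_K\mid x)$: independent messages $W_k$ uniform on finite nonempty $\mathcal M_k$. Classical scheme: stochastic encoder $X^{[n]}=\phi(W_1,\dots,W_K)$, stochastic decoders $\hat W_k=\psi_k(Y_k^{[n]})$. A $\kappa$-partite NS box is a conditional pmf $\mathcal Z(b_{[\kappa]}\mid a_{[\kappa]})$ (finite output alphabets) such that for every subset of parties, the marginal of their outputs depends only on their own inputs. NS-assisted scheme: a $(K+1)$-partite NS box where the transmitter inputs $(W_1,\dots,W_K)$ and obtains output $U$ sent as $X^{[n]}$, and Rx-$k$ inputs $Y_k^{[n]}$ and obtains $\hat W_k$; joint law $\frac{1}{\prod_k|\mathcal M_k|}\mathcal Z(x^{[n]},\hat w\mid w,y^{[n]})\mathcal N^{\otimes n}(y^{[n]}\mid x^{[n]})$. A rate tuple is achievable if some sequence of schemes has $\max_k\Pr(\hat W_k\ne W_k)\to0$ and $\lim_n\frac1n\log_2|\mathcal M_k^{(n)}|\ge R_k$; capacity region = closure; sum-capacity = max of $\sum_kR_k$ over it. *)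

theory Defs
  imports "HOL-Analysis.Analysis"
begin

text \<open>Conventions. Users/receivers are indexed by k < K. Every finite alphabet is
encoded as an initial segment of nat: the channel input alphabet is {..<nx}, the
output alphabet of receiver k is {..<ny k}, message set M_k is {..<m k}.
Tuples indexed by users and length-n blocks are extensional functions (PiE).\<close>

definition outs :: "nat \<Rightarrow> (nat \<Rightarrow> nat) \<Rightarrow> (nat \<Rightarrow> nat) set" where
  "outs K ny = (\<Pi>\<^sub>E k\<in>{..<K}. {..<ny k})"

definition is_dm_bc :: "nat \<Rightarrow> nat \<Rightarrow> (nat \<Rightarrow> nat) \<Rightarrow> (nat \<Rightarrow> (nat \<Rightarrow> nat) \<Rightarrow> real) \<Rightarrow> bool" where
  "is_dm_bc K nx ny W \<longleftrightarrow> nx \<ge> 1 \<and> (\<forall>k<K. ny k \<ge> 1) \<and>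
     (\<forall>x<nx. (\<forall>y\<in>outs K ny. W x y \<ge> 0) \<and> (\<Sum>y\<in>outs K ny. W x y) = 1)"

definition xblocks :: "nat \<Rightarrow> nat \<Rightarrow> (nat \<Rightarrow> nat) set" where
  "xblocks nx n = (\<Pi>\<^sub>E t\<in>{..<n}. {..<nx})"

definition yblock :: "nat \<Rightarrow> nat \<Rightarrow> (nat \<Rightarrow> nat) set" where
  "yblock a n = (\<Pi>\<^sub>E t\<in>{..<n}. {..<a})"

definition yblocks :: "nat \<Rightarrow> (nat \<Rightarrow> nat) \<Rightarrow> nat \<Rightarrow> (nat \<Rightarrow> nat \<Rightarrow> nat) set" where
  "yblocks K ny n = (\<Pi>\<^sub>E k\<in>{..<K}. yblock (ny k) n)"

definition msgs :: "nat \<Rightarrow> (nat \<Rightarrow> nat) \<Rightarrow> (nat \<Rightarrow> nat) set" where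
  "msgs K m = (\<Pi>\<^sub>E k\<in>{..<K}. {..<m k})"

definition chan_n :: "(nat \<Rightarrow> (nat \<Rightarrow> nat) \<Rightarrow> real) \<Rightarrow> nat \<Rightarrow> nat \<Rightarrow> (nat \<Rightarrow> nat) \<Rightarrow> (nat \<Rightarrow> nat \<Rightarrow> nat) \<Rightarrow> real" where
  "chan_n W K n x yy = (\<Prod>t<n. W (x t) (\<lambda>k\<in>{..<K}. yy k t))"

text \<open>enc w x = Pr(X^[n] = x | messages w); dec k y j = Pr(Wh_k = j | Y_k^[n] = y).\<close>
definition classical_scheme :: "nat \<Rightarrow> nat \<Rightarrow> (nat \<Rightarrow> nat) \<Rightarrow> nat \<Rightarrow> (nat \<Rightarrow> nat)
    \<Rightarrow> ((nat \<Rightarrow> nat) \<Rightarrow> (nat \<Rightarrow> nat) \<Rightarrow> real) \<Rightarrow> (nat \<Rightarrow> (nat \<Rightarrow> nat) \<Rightarrow> nat \<Rightarrow> real) \<Rightarrow> bool" where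
  "classical_scheme K nx ny n m enc dec \<longleftrightarrow>
     (\<forall>k<K. m k \<ge> 1) \<and>
     (\<forall>w\<in>msgs K m. (\<forall>x\<in>xblocks nx n. enc w x \<ge> 0) \<and> (\<Sum>x\<in>xblocks nx n. enc w x) = 1) \<and>
     (\<forall>k<K. \<forall>y\<in>yblock (ny k) n. (\<forall>j<m k. dec k y j \<ge> 0) \<and> (\<Sum>j<m k. dec k y j) = 1)"

definition classical_err :: "nat \<Rightarrow> nat \<Rightarrow> (nat \<Rightarrow> nat) \<Rightarrow> (nat \<Rightarrow> (nat \<Rightarrow> nat) \<Rightarrow> real) \<Rightarrow> nat \<Rightarrow> (nat \<Rightarrow> nat)
    \<Rightarrow> ((nat \<Rightarrow> nat) \<Rightarrow> (nat \<Rightarrow> nat) \<Rightarrow> real) \<Rightarrow> (nat \<Rightarrow> (nat \<Rightarrow> nat) \<Rightarrow> nat \<Rightarrow> real) \<Rightarrow> nat \<Rightarrow> real" where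
  "classical_err K nx ny W n m enc dec k =
     (1 / real (\<Prod>i<K. m i)) *
     (\<Sum>w\<in>msgs K m. \<Sum>x\<in>xblocks nx n. \<Sum>yy\<in>yblocks K ny n.
        enc w x * chan_n W K n x yy * (\<Sum>j\<in>{..<m k} - {w k}. dec k (yy k) j))"

text \<open>Z w yy x wh = Z(x^[n], wh | w, y^[n]): the transmitter (party 0) inputs the
message tuple w and outputs x; receiver k inputs yy k and outputs wh k.
ns_marg t S computes the marginal of the outputs of the parties in
S (receivers) together with the transmitter iff t.\<close>
definition ns_marg :: "nat \<Rightarrow> nat \<Rightarrow> nat \<Rightarrow> (nat \<Rightarrow> nat)
    \<Rightarrow> ((nat \<Rightarrow> nat) \<Rightarrow> (nat \<Rightarrow> nat \<Rightarrow> nat) \<Rightarrow> (nat \<Rightarrow> nat) \<Rightarrow> (nat \<Rightarrow> nat) \<Rightarrow> real)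
    \<Rightarrow> bool \<Rightarrow> nat set \<Rightarrow> (nat \<Rightarrow> nat) \<Rightarrow> (nat \<Rightarrow> nat \<Rightarrow> nat) \<Rightarrow> (nat \<Rightarrow> nat) \<Rightarrow> (nat \<Rightarrow> nat) \<Rightarrow> real" where
  "ns_marg K nx n m Z t S w yy x0 wh0 =
     (\<Sum>x\<in>xblocks nx n. \<Sum>wh\<in>msgs K m.
        if (t \<longrightarrow> x = x0) \<and> (\<forall>k\<in>S. wh k = wh0 k) then Z w yy x wh else 0)"

definition ns_scheme :: "nat \<Rightarrow> nat \<Rightarrow> (nat \<Rightarrow> nat) \<Rightarrow> nat \<Rightarrow> (nat \<Rightarrow> nat)
    \<Rightarrow> ((nat \<Rightarrow> nat) \<Rightarrow> (nat \<Rightarrow> nat \<Rightarrow> nat) \<Rightarrow> (nat \<Rightarrow> nat) \<Rightarrow> (nat \<Rightarrow> nat) \<Rightarrow> real) \<Rightarrow> bool" where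
  "ns_scheme K nx ny n m Z \<longleftrightarrow>
     (\<forall>k<K. m k \<ge> 1) \<and>
     (\<forall>w\<in>msgs K m. \<forall>yy\<in>yblocks K ny n.
        (\<forall>x\<in>xblocks nx n. \<forall>wh\<in>msgs K m. Z w yy x wh \<ge> 0) \<and>
        (\<Sum>x\<in>xblocks nx n. \<Sum>wh\<in>msgs K m. Z w yy x wh) = 1) \<and>
     (\<forall>t S w w' yy yy' x0 wh0. S \<subseteq> {..<K} \<and> w \<in> msgs K m \<and> w' \<in> msgs K m \<and>
        yy \<in> yblocks K ny n \<and> yy' \<in> yblocks K ny n \<and> (t \<longrightarrow> w = w') \<and>
        (\<forall>k\<in>S. yy k = yy' k) \<and> x0 \<in> xblocks nx n \<and> wh0 \<in> msgs K m \<longrightarrow>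
        ns_marg K nx n m Z t S w yy x0 wh0 = ns_marg K nx n m Z t S w' yy' x0 wh0)"

definition ns_err :: "nat \<Rightarrow> nat \<Rightarrow> (nat \<Rightarrow> nat) \<Rightarrow> (nat \<Rightarrow> (nat \<Rightarrow> nat) \<Rightarrow> real) \<Rightarrow> nat \<Rightarrow> (nat \<Rightarrow> nat)
    \<Rightarrow> ((nat \<Rightarrow> nat) \<Rightarrow> (nat \<Rightarrow> nat \<Rightarrow> nat) \<Rightarrow> (nat \<Rightarrow> nat) \<Rightarrow> (nat \<Rightarrow> nat) \<Rightarrow> real) \<Rightarrow> nat \<Rightarrow> real" where
  "ns_err K nx ny W n m Z k =
     (1 / real (\<Prod>i<K. m i)) *
     (\<Sum>w\<in>msgs K m. \<Sum>yy\<in>yblocks K ny n. \<Sum>x\<in>xblocks nx n. \<Sum>wh\<in>msgs K m.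
        if wh k \<noteq> w k then Z w yy x wh * chan_n W K n x yy else 0)"

definition achievable_C :: "nat \<Rightarrow> nat \<Rightarrow> (nat \<Rightarrow> nat) \<Rightarrow> (nat \<Rightarrow> (nat \<Rightarrow> nat) \<Rightarrow> real) \<Rightarrow> (nat \<Rightarrow> real) \<Rightarrow> bool" where
  "achievable_C K nx ny W R \<longleftrightarrow> (\<forall>k\<ge>K. R k = 0) \<and>
     (\<exists>m enc dec. (\<forall>n. classical_scheme K nx ny n (m n) (enc n) (dec n)) \<and>
        (\<lambda>n. Max ((\<lambda>k. classical_err K nx ny W n (m n) (enc n) (dec n) k) ` {..<K})) \<longlonglongrightarrow> 0 \<and>
        (\<forall>k<K. \<exists>L. (\<lambda>n. log 2 (real (m n k)) / real n) \<longlonglongrightarrow> L \<and> L \<ge> R k))"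

definition achievable_NS :: "nat \<Rightarrow> nat \<Rightarrow> (nat \<Rightarrow> nat) \<Rightarrow> (nat \<Rightarrow> (nat \<Rightarrow> nat) \<Rightarrow> real) \<Rightarrow> (nat \<Rightarrow> real) \<Rightarrow> bool" where
  "achievable_NS K nx ny W R \<longleftrightarrow> (\<forall>k\<ge>K. R k = 0) \<and>
     (\<exists>m Z. (\<forall>n. ns_scheme K nx ny n (m n) (Z n)) \<and>
        (\<lambda>n. Max ((\<lambda>k. ns_err K nx ny W n (m n) (Z n) k) ` {..<K})) \<longlonglongrightarrow> 0 \<and>
        (\<forall>k<K. \<exists>L. (\<lambda>n. log 2 (real (m n k)) / real n) \<longlonglongrightarrow> L \<and> L \<ge> R k))"

definition cap_region_C where
  "cap_region_C K nx ny W = closure {R. achievable_C K nx ny W R}"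

definition cap_region_NS where
  "cap_region_NS K nx ny W = closure {R. achievable_NS K nx ny W R}"

definition sumcap_C :: "nat \<Rightarrow> nat \<Rightarrow> (nat \<Rightarrow> nat) \<Rightarrow> (nat \<Rightarrow> (nat \<Rightarrow> nat) \<Rightarrow> real) \<Rightarrow> real" where
  "sumcap_C K nx ny W = Sup ((\<lambda>R. \<Sum>k<K. R k) ` cap_region_C K nx ny W)"

definition sumcap_NS :: "nat \<Rightarrow> nat \<Rightarrow> (nat \<Rightarrow> nat) \<Rightarrow> (nat \<Rightarrow> (nat \<Rightarrow> nat) \<Rightarrow> real) \<Rightarrow> real" where
  "sumcap_NS K nx ny W = Sup ((\<lambda>R. \<Sum>k<K. R k) ` cap_region_NS K nx ny W)"

end

theory Submission
  imports Defs "HOL-Computational_Algebra.Primes" "HOL-Computational_Algebra.Polynomial"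
begin

text \<open>
  Upper bound. A non-signalling code with \<open>M\<close> messages and error \<open>\<epsilon>\<close> for one receiver yields, by
  random coding with codewords drawn from the box's own input law, a classical code for that receiver with
  \<open>l\<close> messages and error at most \<open>\<epsilon> + (l - 1) / M\<close>. Taking \<open>l = M div n\<close> costs no rate, so
  each single-user rate of a non-signalling scheme is classically achievable and is at most the classical
  sum-capacity.

  Lower bound. The input is a polynomial \<open>x\<close> of degree less than \<open>K\<close> over the field with \<open>p\<close>
  elements, and receiver \<open>k\<close> sees \<open>(t, x(t))\<close> for a uniformly random node \<open>t\<close> in its own block of
  \<open>N = p div K\<close> nodes. Since nodes of different receivers differ, interpolation makes the values
  \<open>x(t)\<close> jointly uniform, and the box that outputs a uniform \<open>x\<close> and decodes to
  \<open>w + y - x(t)\<close> is non-signalling and error-free: every user gets rate \<open>log p\<close>. Classically, two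
  distinct polynomials rarely agree at a random node of any block, so a receiver that has decoded its own
  message can list all codewords compatible with its observation, and the list has size \<open>O(1)^n\<close>
  provided the code restricted to the remaining receivers is decodable. Peeling off the receivers one by
  one bounds the number of message tuples by \<open>O(1)^n p^n\<close>, so the classical sum-capacity is
  \<open>log p + O(1)\<close> and the ratio tends to \<open>K\<close> as \<open>p\<close> grows.
\<close>

section \<open>Sizes and finiteness of the block and message alphabets\<close>

lemma card_xblocks: "card (xblocks a n) = a ^ n" "finite (xblocks a n)"
  unfolding xblocks_def by (auto simp: card_PiE intro: finite_PiE)

lemma finite_yblock: "finite (yblock a n)"
  unfolding yblock_def by (auto intro: finite_PiE)

lemma finite_yblocks: "finite (yblocks K ny n)"
  unfolding yblocks_def by (auto intro!: finite_PiE finite_yblock)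

lemma card_msgs: "card (msgs K m) = (\<Prod>k<K. m k)" "finite (msgs K m)"
  unfolding msgs_def by (auto simp: card_PiE intro: finite_PiE)

section \<open>Random coding\<close>

text \<open>The weight \<open>\<Prod>t<l. \<pi> (c t)\<close> is the law of \<open>l\<close>
  independent draws from \<open>\<pi>\<close>. A function that factors over the entries has a
  product expectation, and entries it does not involve contribute total mass 1.\<close>

lemma sum_codebooks:
  fixes \<pi> :: "'x \<Rightarrow> real"
  assumes X: "finite X" and \<pi>: "(\<Sum>x\<in>X. \<pi> x) = 1"
  shows "(\<Sum>c\<in>{..<l::nat} \<rightarrow>\<^sub>E X. \<Prod>t<l. \<pi> (c t)) = 1"
    and "i < l \<Longrightarrow> (\<Sum>c\<in>{..<l} \<rightarrow>\<^sub>E X. (\<Prod>t<l. \<pi> (c t)) * f (c i)) = (\<Sum>x\<in>X. \<pi> x * f x)"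
    and "i < l \<Longrightarrow> j < l \<Longrightarrow> i \<noteq> j \<Longrightarrow>
      (\<Sum>c\<in>{..<l} \<rightarrow>\<^sub>E X. (\<Prod>t<l. \<pi> (c t)) * (f (c i) * g (c j)))
      = (\<Sum>x\<in>X. \<pi> x * f x) * (\<Sum>x\<in>X. \<pi> x * g x)"
proof -
  have gen: "(\<Sum>c\<in>{..<l} \<rightarrow>\<^sub>E X. (\<Prod>t<l. \<pi> (c t)) * (\<Prod>t<l. h t (c t)))
      = (\<Prod>t<l. \<Sum>x\<in>X. \<pi> x * h t x)" for h :: "nat \<Rightarrow> 'x \<Rightarrow> real"
    using X by (subst prod_sum_PiE) (auto simp: prod.distrib)
  show "(\<Sum>c\<in>{..<l} \<rightarrow>\<^sub>E X. \<Prod>t<l. \<pi> (c t)) = 1"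
    using gen[of "\<lambda>_ _. 1"] \<pi> by simp
  show "(\<Sum>c\<in>{..<l} \<rightarrow>\<^sub>E X. (\<Prod>t<l. \<pi> (c t)) * f (c i)) = (\<Sum>x\<in>X. \<pi> x * f x)" if "i < l"
  proof -
    have "(\<Sum>c\<in>{..<l} \<rightarrow>\<^sub>E X. (\<Prod>t<l. \<pi> (c t)) * f (c i))
        = (\<Prod>t<l. \<Sum>x\<in>X. \<pi> x * (if t = i then f x else 1))"
      unfolding gen[symmetric] using that by simp
    also have "\<dots> = (\<Prod>t<l. if t = i then (\<Sum>x\<in>X. \<pi> x * f x) else 1)"
      using \<pi> by (intro prod.cong) auto
    finally show ?thesis using that by simp
  qed
  show "(\<Sum>c\<in>{..<l} \<rightarrow>\<^sub>E X. (\<Prod>t<l. \<pi> (c t)) * (f (c i) * g (c j)))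
      = (\<Sum>x\<in>X. \<pi> x * f x) * (\<Sum>x\<in>X. \<pi> x * g x)" if "i < l" "j < l" "i \<noteq> j"
  proof -
    have "(\<Sum>c\<in>{..<l} \<rightarrow>\<^sub>E X. (\<Prod>t<l. \<pi> (c t)) * (f (c i) * g (c j)))
        = (\<Prod>t<l. \<Sum>x\<in>X. \<pi> x * ((if t = i then f x else 1) * (if t = j then g x else 1)))"
      unfolding gen[symmetric] using that by (simp add: prod.distrib)
    also have "\<dots> = (\<Prod>t<l. (if t = i then (\<Sum>x\<in>X. \<pi> x * f x) else 1) * (if t = j then (\<Sum>x\<in>X. \<pi> x * g x) else 1))"
      using \<pi> that by (intro prod.cong) auto
    finally show ?thesis using that by (simp add: prod.distrib)
  qed
qed

text \<open>Here \<open>a\<close> is to be the score of the correct codeword and \<open>b\<close>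
  the total score of the others, and the right side is the normalised score. For
  \<open>s = a + b > 1\<close> the point is \<open>1 / s \<ge> 2 - s\<close>, and
  \<open>2 - s \<ge> 1 - b\<close> because \<open>a \<le> 1\<close>.\<close>

lemma div_max_ge:
  fixes a b :: real
  assumes "0 \<le> a" "a \<le> 1" "0 \<le> b"
  shows "a * (1 - b) \<le> a / max 1 (a + b)"
proof -
  have "1 - b \<le> 1 / max 1 (a + b)"
  proof (cases "a + b \<le> 1")
    case True
    then show ?thesis using assms by (simp add: max_def)
  next
    case False
    have "(1 - b) * (a + b) \<le> (2 - (a + b)) * (a + b)"
      using assms False by (intro mult_right_mono) auto
    also have "\<dots> = 1 - (a + b - 1)\<^sup>2" by (simp add: power2_eq_square algebra_simps)
    also have "\<dots> \<le> 1" by simp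
    finally show ?thesis using False by (simp add: max_def pos_le_divide_eq)
  qed
  then have "a * (1 - b) \<le> a * (1 / max 1 (a + b))" using assms by (intro mult_left_mono) auto
  then show ?thesis by simp
qed

text \<open>Codewords are drawn independently from \<open>\<pi>\<close>. A codeword \<open>x\<close> passes the test for output \<open>y\<close> with
  weight \<open>\<rho> x y / \<pi> x\<close>, which on average over \<open>x\<close> is \<open>1 / M\<close>, so that \<open>l - 1\<close> wrong codewords
  cost at most \<open>(l - 1) / M\<close>; only pairwise independence enters.\<close>
lemma random_coding:
  fixes V \<rho> :: "'x \<Rightarrow> 'y \<Rightarrow> real" and \<pi> :: "'x \<Rightarrow> real" and l :: nat
  assumes X: "finite X" and Y: "finite Y"
    and V: "\<And>x y. x \<in> X \<Longrightarrow> y \<in> Y \<Longrightarrow> V x y \<ge> 0"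
    and \<pi>: "\<And>x. x \<in> X \<Longrightarrow> \<pi> x \<ge> 0" "(\<Sum>x\<in>X. \<pi> x) = 1"
    and \<rho>: "\<And>x y. x \<in> X \<Longrightarrow> y \<in> Y \<Longrightarrow> 0 \<le> \<rho> x y \<and> \<rho> x y \<le> \<pi> x"
    and \<rho>1: "\<And>y. y \<in> Y \<Longrightarrow> (\<Sum>x\<in>X. \<rho> x y) = 1 / M"
    and l: "l \<ge> 1"
  shows "\<exists>c\<in>{..<l} \<rightarrow>\<^sub>E X. \<exists>d :: 'y \<Rightarrow> nat \<Rightarrow> real.
     (\<forall>y\<in>Y. (\<forall>i<l. d y i \<ge> 0) \<and> (\<Sum>i<l. d y i) = 1) \<and>
     real l * ((\<Sum>x\<in>X. \<Sum>y\<in>Y. V x y * \<rho> x y) * (1 - (real l - 1) / M))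
       \<le> (\<Sum>i<l. \<Sum>y\<in>Y. V (c i) y * d y i)"
proof -
  \<comment> \<open>If \<open>\<pi> x = 0\<close> then \<open>\<rho> x y = 0\<close> as well, and
    division by zero gives 0, so \<open>\<pi> x * q x y = \<rho> x y\<close> holds in that case
    too.\<close>
  define q where "q x y = \<rho> x y / \<pi> x" for x y
  have q: "0 \<le> q x y" "q x y \<le> 1" "\<pi> x * q x y = \<rho> x y" if "x \<in> X" "y \<in> Y" for x y
    using \<rho>[OF that] \<pi>(1)[OF that(1)] unfolding q_def by (auto simp: divide_le_eq_1)
  define C where "C = ({..<l} \<rightarrow>\<^sub>E X)"
  have finC: "finite C" unfolding C_def using X by (auto intro: finite_PiE)
  have CX: "c i \<in> X" if "c \<in> C" "i < l" for c i using that unfolding C_def by auto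
  define P where "P c = (\<Prod>t<l. \<pi> (c t))" for c
  have P0: "P c \<ge> 0" if "c \<in> C" for c unfolding P_def using \<pi>(1) CX[OF that] by (intro prod_nonneg) auto
  have P1: "(\<Sum>c\<in>C. P c) = 1" unfolding C_def P_def by (rule sum_codebooks(1)[OF X \<pi>(2)])
  \<comment> \<open>By \<open>div_max_ge\<close> this is a lower bound for the total success of the
    normalised decoder. Each term involves at most two codewords, so its mean over codebooks is
    computed exactly.\<close>
  define G where "G c = (\<Sum>i<l. \<Sum>y\<in>Y. V (c i) y * q (c i) y * (1 - (\<Sum>j\<in>{..<l} - {i}. q (c j) y)))" for c
  define a where "a y = (\<Sum>x\<in>X. V x y * \<rho> x y)" for y
  define B where "B = real l * ((\<Sum>x\<in>X. \<Sum>y\<in>Y. V x y * \<rho> x y) * (1 - (real l - 1) / M))"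
  have EG: "(\<Sum>c\<in>C. P c * G c) = B"
  proof -
    have inner: "(\<Sum>c\<in>C. P c * (V (c i) y * q (c i) y * (1 - (\<Sum>j\<in>{..<l} - {i}. q (c j) y))))
        = a y * (1 - (real l - 1) / M)" if i: "i < l" and y: "y \<in> Y" for i y
    proof -
      have eq: "(\<Sum>x\<in>X. \<pi> x * (V x y * q x y)) = a y"
        unfolding a_def using q(3) y by (intro sum.cong) (auto simp: mult_ac)
      have eq1: "(\<Sum>x\<in>X. \<pi> x * q x y) = 1 / M"
        using q(3) y \<rho>1[OF y] by simp
      have "(\<Sum>c\<in>C. P c * (V (c i) y * q (c i) y * (1 - (\<Sum>j\<in>{..<l} - {i}. q (c j) y))))
          = (\<Sum>c\<in>C. P c * (V (c i) y * q (c i) y))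
            - (\<Sum>c\<in>C. \<Sum>j\<in>{..<l} - {i}. P c * (V (c i) y * q (c i) y * q (c j) y))"
        by (simp add: right_diff_distrib sum_subtractf sum_distrib_left)
      also have "(\<Sum>c\<in>C. P c * (V (c i) y * q (c i) y)) = a y"
        unfolding C_def P_def using sum_codebooks(2)[OF X \<pi>(2) i, of "\<lambda>x. V x y * q x y"] eq by simp
      also have "(\<Sum>c\<in>C. \<Sum>j\<in>{..<l} - {i}. P c * (V (c i) y * q (c i) y * q (c j) y))
          = (\<Sum>j\<in>{..<l} - {i}. a y * (1 / M))"
        unfolding C_def P_def
        by (subst sum.swap, rule sum.cong[OF refl])
          (use sum_codebooks(3)[OF X \<pi>(2) i, of _ "\<lambda>x. V x y * q x y" "\<lambda>x. q x y"] eq eq1 in auto)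
      also have "\<dots> = (real l - 1) * (a y * (1 / M))"
        using i by (simp add: of_nat_diff)
      finally show ?thesis by (simp add: algebra_simps)
    qed
    have "(\<Sum>c\<in>C. P c * G c) = (\<Sum>i<l. \<Sum>y\<in>Y. \<Sum>c\<in>C.
        P c * (V (c i) y * q (c i) y * (1 - (\<Sum>j\<in>{..<l} - {i}. q (c j) y))))"
      unfolding G_def sum_distrib_left
      by (subst sum.swap, rule sum.cong[OF refl], rule sum.swap)
    also have "\<dots> = (\<Sum>i<l. \<Sum>y\<in>Y. a y * (1 - (real l - 1) / M))"
      using inner by simp
    also have "\<dots> = real l * ((\<Sum>y\<in>Y. a y) * (1 - (real l - 1) / M))"
      by (simp add: sum_distrib_right)
    also have "(\<Sum>y\<in>Y. a y) = (\<Sum>x\<in>X. \<Sum>y\<in>Y. V x y * \<rho> x y)"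
      unfolding a_def by (rule sum.swap)
    finally show ?thesis unfolding B_def .
  qed
  have "C \<noteq> {}" using P1 by auto
  then have "Max (G ` C) \<in> G ` C" using finC by (intro Max_in) auto
  then obtain c where c: "c \<in> C" "G c = Max (G ` C)" by auto
  have "B \<le> (\<Sum>c'\<in>C. P c' * G c)"
    unfolding EG[symmetric] c(2) using finC P0 by (intro sum_mono mult_left_mono Max_ge) auto
  then have BG: "B \<le> G c" using P1 by (simp flip: sum_distrib_right)
  define s where "s y = (\<Sum>j<l. q (c j) y)" for y
  \<comment> \<open>Scores are scaled down only if they sum to more than 1; \<open>d\<close> below
    gives the missing mass to message 0, which exists because \<open>l \<ge> 1\<close>, and this
    never lowers the success.\<close>
  define d0 where "d0 y i = q (c i) y / max 1 (s y)" for y i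
  define d where "d y i = d0 y i + (if i = 0 then 1 - (\<Sum>j<l. d0 y j) else 0)" for y i
  have d0: "d0 y i \<ge> 0" if "y \<in> Y" "i < l" for y i
    unfolding d0_def using q(1)[OF CX[OF c(1) that(2)] that(1)] by (intro divide_nonneg_nonneg) auto
  have sum_d0: "(\<Sum>j<l. d0 y j) \<le> 1" for y
    unfolding d0_def by (simp add: divide_le_eq_1 less_max_iff_disj flip: sum_divide_distrib s_def)
  have d: "d y i \<ge> d0 y i" for y i unfolding d_def using sum_d0[of y] by simp
  have d1: "(\<Sum>i<l. d y i) = 1" for y
    unfolding d_def using l by (simp add: sum.distrib)
  have "G c \<le> (\<Sum>i<l. \<Sum>y\<in>Y. V (c i) y * d y i)"
    unfolding G_def mult.assoc
  proof (intro sum_mono mult_left_mono)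
    fix i y assume i: "i \<in> {..<l}" and y: "y \<in> Y"
    then show "V (c i) y \<ge> 0" using V CX c(1) by auto
    have s: "s y = q (c i) y + (\<Sum>j\<in>{..<l} - {i}. q (c j) y)"
      unfolding s_def using i by (simp add: sum.remove)
    have "q (c i) y * (1 - (\<Sum>j\<in>{..<l} - {i}. q (c j) y)) \<le> d0 y i"
      unfolding d0_def s using i y CX[OF c(1)] q by (intro div_max_ge sum_nonneg) auto
    then show "q (c i) y * (1 - (\<Sum>j\<in>{..<l} - {i}. q (c j) y)) \<le> d y i"
      using d[of y i] by linarith
  qed
  then have "B \<le> (\<Sum>i<l. \<Sum>y\<in>Y. V (c i) y * d y i)" using BG by linarith
  moreover have "\<forall>y\<in>Y. (\<forall>i<l. d y i \<ge> 0) \<and> (\<Sum>i<l. d y i) = 1"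
    using d d0 d1 order_trans by blast
  ultimately show ?thesis unfolding B_def using c(1) unfolding C_def by blast
qed

section \<open>Polynomial evaluation modulo a prime\<close>

text \<open>Lagrange's bound on roots modulo \<open>p\<close>, phrased over the integers. Splitting
  off a root \<open>a\<close> leaves a quotient \<open>g\<close>; at any other root \<open>t\<close>
  the prime \<open>p\<close> divides \<open>(t - a) * poly g t\<close> but not \<open>t - a\<close>,
  so \<open>g\<close> keeps the remaining roots at one degree less.\<close>

lemma const_dvd_poly_of_many_roots:
  fixes f :: "int poly" and p :: int
  assumes p: "prime p" and "finite T" "degree f < card T"
    and "\<And>s t. s \<in> T \<Longrightarrow> t \<in> T \<Longrightarrow> p dvd s - t \<Longrightarrow> s = t"
    and "\<And>t. t \<in> T \<Longrightarrow> p dvd poly f t"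
  shows "[:p:] dvd f"
  using assms(2-)
proof (induction "degree f" arbitrary: f T)
  case 0
  then obtain t where "t \<in> T" by fastforce
  moreover obtain c where "f = [:c:]" using 0(1) by (metis degree_eq_zeroE)
  ultimately show ?case using 0(5)[of t] by simp
next
  case (Suc d)
  then obtain a where a: "a \<in> T" by fastforce
  define g where "g = synthetic_div f a"
  have f_eq: "f = [:-a, 1:] * g + [:poly f a:]"
    unfolding g_def by (rule synthetic_div_correct'[symmetric])
  have "[:p:] dvd g"
  proof (rule Suc.hyps(1)[of g "T - {a}"])
    show "d = degree g" unfolding g_def using Suc.hyps(2) by (simp add: degree_synthetic_div)
    then show "degree g < card (T - {a})" using Suc a by simp
    fix t assume t: "t \<in> T - {a}"
    have "poly f t = (t - a) * poly g t + poly f a"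
      by (subst f_eq) (simp add: algebra_simps)
    then have "p dvd (t - a) * poly g t"
      using Suc.prems(4)[of t] Suc.prems(4)[OF a] t by (metis Diff_iff dvd_add_left_iff)
    then show "p dvd poly g t"
      using p prime_dvd_mult_iff Suc.prems(3)[of t a] t a by blast
  qed (use Suc in auto)
  then show ?case
    using Suc.prems(4)[OF a] by (subst f_eq) (simp add: dvd_add dvd_mult del: mult_pCons_left)
qed

lemma eq_of_eq_digits:
  fixes x y p :: nat
  assumes "x < p ^ K" "y < p ^ K" "\<And>i. i < K \<Longrightarrow> x div p ^ i mod p = y div p ^ i mod p"
  shows "x = y"
  using assms
proof (induction K arbitrary: x y)
  case (Suc K)
  have "x div p = y div p"
  proof (rule Suc.IH)
    show "x div p < p ^ K" "y div p < p ^ K"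
      using Suc.prems(1,2) by (simp_all add: less_mult_imp_div_less mult.commute)
    show "x div p div p ^ i mod p = y div p div p ^ i mod p" if "i < K" for i
      using Suc.prems(3)[of "Suc i"] that by (simp add: div_mult2_eq)
  qed
  moreover have "x mod p = y mod p" using Suc.prems(3)[of 0] by simp
  ultimately show ?case by (metis div_mult_mod_eq)
qed simp

text \<open>The base-\<open>p\<close> digits of \<open>x\<close> are the coefficients of a polynomial, evaluated at \<open>t\<close> modulo \<open>p\<close>.\<close>
definition rs_eval :: "nat \<Rightarrow> nat \<Rightarrow> nat \<Rightarrow> nat \<Rightarrow> nat" where
  "rs_eval p K t x = (\<Sum>i<K. (x div p ^ i mod p) * t ^ i) mod p"

text \<open>The digitwise difference of \<open>x\<close> and \<open>y\<close> gives a polynomial of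
  degree less than \<open>K\<close> with at least \<open>K\<close> roots modulo \<open>p\<close>, so
  \<open>p\<close> divides every coefficient; digits below \<open>p\<close> that agree modulo
  \<open>p\<close> are equal.\<close>

lemma rs_eval_inj:
  assumes p: "prime p" and T: "T \<subseteq> {..<p}" "K \<le> card T" and x: "x < p ^ K" "y < p ^ K"
    and eq: "\<And>t. t \<in> T \<Longrightarrow> rs_eval p K t x = rs_eval p K t y"
  shows "x = y"
proof (cases "K = 0")
  case True
  then show ?thesis using x by simp
next
  case False
  define c where "c i = int (x div p ^ i mod p) - int (y div p ^ i mod p)" for i
  define f where "f = (\<Sum>i<K. monom (c i) i)"
  have "degree f \<le> K - 1"
    unfolding f_def by (intro degree_sum_le) (auto intro: order_trans[OF degree_monom_le])
  then have deg: "degree f < card (int ` T)"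
    using False T(2) by (simp add: card_image)
  have dvd: "[:int p:] dvd f"
  proof (rule const_dvd_poly_of_many_roots[OF _ _ deg])
    show "prime (int p)" using p by simp
    show "finite (int ` T)" using T(1) finite_subset by blast
    show "s = t" if "s \<in> int ` T" "t \<in> int ` T" "int p dvd s - t" for s t
    proof -
      have "s \<in> {0..<int p}" "t \<in> {0..<int p}" using that(1,2) T(1) by auto
      with that(3) show ?thesis
        by (metis atLeastLessThan_iff mod_eq_dvd_iff mod_pos_pos_trivial)
    qed
    show "int p dvd poly f s" if "s \<in> int ` T" for s
    proof -
      obtain t where t: "t \<in> T" "s = int t" using \<open>s \<in> int ` T\<close> by blast
      have "poly f s = int (\<Sum>i<K. (x div p ^ i mod p) * t ^ i) - int (\<Sum>i<K. (y div p ^ i mod p) * t ^ i)"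
        unfolding f_def c_def t by (simp add: poly_sum poly_monom algebra_simps sum_subtractf)
      moreover have "int (\<Sum>i<K. (x div p ^ i mod p) * t ^ i) mod int p
          = int (\<Sum>i<K. (y div p ^ i mod p) * t ^ i) mod int p"
        using eq[OF t(1)] unfolding rs_eval_def by (metis zmod_int)
      ultimately show ?thesis by (simp only: mod_eq_dvd_iff)
    qed
  qed
  show ?thesis
  proof (rule eq_of_eq_digits[OF x])
    fix i assume i: "i < K"
    have "coeff f i = c i"
      unfolding f_def using i by (simp add: coeff_sum if_distrib sum.delta cong: if_cong)
    then have "int p dvd c i" using dvd by (metis const_poly_dvd_iff)
    moreover have "x div p ^ i mod p < p" "y div p ^ i mod p < p"
      using p by (simp_all add: prime_gt_0_nat)
    ultimately show "x div p ^ i mod p = y div p ^ i mod p"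
      unfolding c_def by (metis mod_mod_trivial mod_eq_dvd_iff of_nat_eq_iff zmod_int)
  qed
qed

lemma rs_eval_less: "prime p \<Longrightarrow> rs_eval p K t x < p"
  by (simp add: rs_eval_def prime_gt_0_nat)

section \<open>List decoding\<close>

text \<open>Dividing by the fibre size models a uniform guess from the list of preimages: the
  members of one fibre together count once.\<close>

lemma sum_div_card_fibre:
  fixes g :: "'b \<Rightarrow> real"
  assumes "finite S"
  shows "(\<Sum>w\<in>S. g (f w) / real (card {w'\<in>S. f w' = f w})) = (\<Sum>b\<in>f ` S. g b)"
proof -
  have "(\<Sum>w\<in>S. g (f w) / real (card {w'\<in>S. f w' = f w}))
      = (\<Sum>b\<in>f ` S. \<Sum>w\<in>{w\<in>S. f w = b}. g (f w) / real (card {w'\<in>S. f w' = f w}))"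
    by (rule sum.image_gen[OF assms])
  also have "\<dots> = (\<Sum>b\<in>f ` S. g b)"
  proof (rule sum.cong[OF refl])
    fix b assume "b \<in> f ` S"
    then have "card {w'\<in>S. f w' = b} > 0"
      using assms by (auto simp: card_gt_0_iff)
    then show "(\<Sum>w\<in>{w\<in>S. f w = b}. g (f w) / real (card {w'\<in>S. f w' = f w})) = g b"
      by simp
  qed
  finally show ?thesis .
qed

text \<open>The output block of a receiver whose random nodes have indices \<open>\<tau>\<close>.
  Each symbol packs a node index and a value below \<open>p\<close> into one number, to be unpacked
  by \<open>div p\<close> and \<open>mod p\<close>.\<close>

definition obs :: "nat \<Rightarrow> nat \<Rightarrow> (nat \<Rightarrow> nat \<Rightarrow> nat) \<Rightarrow> (nat \<Rightarrow> nat) \<Rightarrow> (nat \<Rightarrow> nat) \<Rightarrow> nat \<Rightarrow> nat" where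
  "obs p n F \<tau> x = (\<lambda>t\<in>{..<n}. \<tau> t * p + F (\<tau> t) (x t))"

lemma sum_Pow_power:
  fixes c :: real
  assumes "finite J"
  shows "(\<Sum>I\<in>Pow J. c ^ card I) = (1 + c) ^ card J"
proof -
  have "(\<Prod>i\<in>J. c + 1) = (\<Sum>I\<in>Pow J. (\<Prod>i\<in>I. c) * (\<Prod>i\<in>J-I. 1))"
    by (rule prod_add[OF assms])
  then show ?thesis by (simp add: add.commute)
qed

text \<open>Nodes are chosen position by position, so the count is a product: a position with equal
  symbols admits all \<open>N\<close> nodes, one with different symbols at most
  \<open>D\<close>.\<close>

lemma card_obs_agree:
  assumes agree: "\<And>a b. a \<in> A \<Longrightarrow> b \<in> A \<Longrightarrow> a \<noteq> b \<Longrightarrow> card {\<tau>\<in>{..<N}. F \<tau> a = F \<tau> b} \<le> D"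
    and N: "N \<ge> 1" and x: "\<And>t. t < n \<Longrightarrow> x t \<in> A" "\<And>t. t < n \<Longrightarrow> y t \<in> A"
  shows "real (card {\<tau>\<in>{..<n} \<rightarrow>\<^sub>E {..<N}. obs p n F \<tau> x = obs p n F \<tau> y})
     \<le> real N ^ n * (real D / real N) ^ card {t\<in>{..<n}. x t \<noteq> y t}"
proof -
  have "obs p n F \<tau> x = obs p n F \<tau> y \<longleftrightarrow> (\<forall>t<n. F (\<tau> t) (x t) = F (\<tau> t) (y t))" for \<tau>
    by (auto simp: obs_def fun_eq_iff restrict_def)
  then have "{\<tau>\<in>{..<n} \<rightarrow>\<^sub>E {..<N}. obs p n F \<tau> x = obs p n F \<tau> y}
      = (\<Pi>\<^sub>E t\<in>{..<n}. {\<sigma>\<in>{..<N}. F \<sigma> (x t) = F \<sigma> (y t)})"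
    by (auto simp: PiE_iff extensional_def)
  then have "real (card {\<tau>\<in>{..<n} \<rightarrow>\<^sub>E {..<N}. obs p n F \<tau> x = obs p n F \<tau> y})
      = (\<Prod>t<n. real (card {\<sigma>\<in>{..<N}. F \<sigma> (x t) = F \<sigma> (y t)}))"
    by (simp add: card_PiE)
  also have "\<dots> \<le> (\<Prod>t<n. real N * (if x t \<noteq> y t then real D / real N else 1))"
  proof (rule prod_mono)
    fix t assume "t \<in> {..<n}"
    then show "0 \<le> real (card {\<sigma>\<in>{..<N}. F \<sigma> (x t) = F \<sigma> (y t)}) \<and>
        real (card {\<sigma>\<in>{..<N}. F \<sigma> (x t) = F \<sigma> (y t)}) \<le> real N * (if x t \<noteq> y t then real D / real N else 1)"
      using agree[of "x t" "y t"] x N by auto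
  qed
  also have "\<dots> = real N ^ n * (real D / real N) ^ card {t\<in>{..<n}. x t \<noteq> y t}"
    by (simp add: prod.distrib prod.If_cases Int_def)
  finally show ?thesis .
qed

text \<open>Once the nodes are fixed, positions outside \<open>J\<close> carry a common value, so an
  observation is determined by its values, \<open>p\<close> candidates each, at the positions of
  \<open>J\<close>.\<close>

lemma card_obs_image:
  assumes F: "\<And>\<sigma> a. F \<sigma> a < p" and J: "J \<subseteq> {..<n}"
    and out: "\<And>w w' t. w \<in> S \<Longrightarrow> w' \<in> S \<Longrightarrow> t < n \<Longrightarrow> t \<notin> J \<Longrightarrow> x w t = x w' t"
  shows "card ((\<lambda>w. obs p n F \<tau> (x w)) ` S) \<le> p ^ card J"
proof (cases "S = {}")
  case False
  then obtain w0 where w0: "w0 \<in> S" by blast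
  have fJ: "finite J" using J finite_subset by blast
  define h where "h v = (\<lambda>t\<in>{..<n}. \<tau> t * p + (if t \<in> J then v t else F (\<tau> t) (x w0 t)))" for v
  have "(\<lambda>w. obs p n F \<tau> (x w)) ` S \<subseteq> h ` (J \<rightarrow>\<^sub>E {..<p})"
  proof
    fix y assume "y \<in> (\<lambda>w. obs p n F \<tau> (x w)) ` S"
    then obtain w where w: "w \<in> S" "y = obs p n F \<tau> (x w)" by blast
    have "y = h (\<lambda>t\<in>J. F (\<tau> t) (x w t))"
      unfolding w h_def obs_def using J out[OF w(1) w0] by (auto simp: fun_eq_iff)
    moreover have "(\<lambda>t\<in>J. F (\<tau> t) (x w t)) \<in> J \<rightarrow>\<^sub>E {..<p}" using F by auto
    ultimately show "y \<in> h ` (J \<rightarrow>\<^sub>E {..<p})" by blast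
  qed
  then have "card ((\<lambda>w. obs p n F \<tau> (x w)) ` S) \<le> card (J \<rightarrow>\<^sub>E {..<p})"
    using fJ by (intro surj_card_le) (auto intro: finite_PiE)
  then show ?thesis using fJ by (simp add: card_PiE)
qed simp

text \<open>A decoder of the label \<open>l w\<close> that succeeds with probability one half extends to a list decoder
  of \<open>w\<close> itself: given the observation and the label, the expected number of compatible codewords is
  at most \<open>B * r ^ n\<close>. Guessing \<open>w\<close> uniformly from that list wins with probability \<open>1 / (4 * B * r ^ n)\<close>,
  while no decoder can do better than the number of observations divided by \<open>card S\<close>.\<close>
lemma list_decoding_bound:
  fixes d :: "(nat \<Rightarrow> nat) \<Rightarrow> nat \<Rightarrow> real" and x :: "'w \<Rightarrow> nat \<Rightarrow> nat"
  assumes fin: "finite S" and N: "N \<ge> 1" and B0: "B \<ge> 0"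
    and F: "\<And>\<sigma> a. F \<sigma> a < p"
    and agree: "\<And>a b. a \<in> A \<Longrightarrow> b \<in> A \<Longrightarrow> a \<noteq> b \<Longrightarrow> card {\<tau>\<in>{..<N}. F \<tau> a = F \<tau> b} \<le> D"
    and xA: "\<And>w t. w \<in> S \<Longrightarrow> t < n \<Longrightarrow> x w t \<in> A"
    and J: "J \<subseteq> {..<n}"
    and out: "\<And>w w' t. w \<in> S \<Longrightarrow> w' \<in> S \<Longrightarrow> t < n \<Longrightarrow> t \<notin> J \<Longrightarrow> x w t = x w' t"
    and d0: "\<And>\<tau> w j. \<tau> \<in> {..<n} \<rightarrow>\<^sub>E {..<N} \<Longrightarrow> w \<in> S \<Longrightarrow> j < m \<Longrightarrow> d (obs p n F \<tau> (x w)) j \<ge> 0"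
    and d1: "\<And>\<tau> w. \<tau> \<in> {..<n} \<rightarrow>\<^sub>E {..<N} \<Longrightarrow> w \<in> S \<Longrightarrow> (\<Sum>j<m. d (obs p n F \<tau> (x w)) j) \<le> 1"
    and l: "\<And>w. w \<in> S \<Longrightarrow> l w < m"
    and succ: "\<And>w. w \<in> S \<Longrightarrow> (\<Sum>\<tau>\<in>{..<n} \<rightarrow>\<^sub>E {..<N}. d (obs p n F \<tau> (x w)) (l w)) \<ge> real N ^ n / 2"
    and sub: "\<And>w J'. w \<in> S \<Longrightarrow> J' \<subseteq> J \<Longrightarrow>
       real (card {w'\<in>S. l w' = l w \<and> (\<forall>t<n. t \<notin> J' \<longrightarrow> x w' t = x w t)}) \<le> B * real p ^ card J'"
  shows "real (card S) \<le> 4 * B * (1 + real p * real D / real N) ^ n * real p ^ card J"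
proof (cases "S = {}")
  case True
  then show ?thesis using B0 by simp
next
  case False
  define T where "T = ({..<n} \<rightarrow>\<^sub>E {..<N})"
  have finT: "finite T" and cardT: "card T = N ^ n"
    unfolding T_def by (auto intro: finite_PiE simp: card_PiE)
  have fJ: "finite J" using J finite_subset by blast
  define r where "r = 1 + real p * real D / real N"
  have r1: "r \<ge> 1" unfolding r_def by simp
  obtain w0 where w0: "w0 \<in> S" using False by blast
  \<comment> \<open>With \<open>J' = {}\<close> the class in \<open>sub\<close> contains
    \<open>w0\<close> itself; this forces \<open>B > 0\<close> and permits division by
    \<open>\<Lambda>\<close>.\<close>
  have "w0 \<in> {w'\<in>S. l w' = l w0 \<and> (\<forall>t<n. t \<notin> {} \<longrightarrow> x w' t = x w0 t)}" using w0 by simp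
  then have "card {w'\<in>S. l w' = l w0 \<and> (\<forall>t<n. t \<notin> {} \<longrightarrow> x w' t = x w0 t)} > 0"
    using fin by (intro card_gt_0_iff[THEN iffD2]) auto
  then have B: "B > 0" using sub[OF w0, of "{}"] by (simp add: less_le_trans)
  define \<Lambda> where "\<Lambda> = B * r ^ n"
  have \<Lambda>: "\<Lambda> > 0" unfolding \<Lambda>_def using B r1 by simp
  define f where "f \<tau> w = (obs p n F \<tau> (x w), l w)" for \<tau> w
  define L where "L \<tau> w = real (card {w'\<in>S. f \<tau> w' = f \<tau> w})" for \<tau> w
  have L1: "L \<tau> w \<ge> 1" if "w \<in> S" for \<tau> w
  proof -
    have "card {w'\<in>S. f \<tau> w' = f \<tau> w} > 0" using that fin by (auto simp: card_gt_0_iff)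
    then show ?thesis unfolding L_def by linarith
  qed
  \<comment> \<open>Competitors are grouped by the set \<open>I\<close> of positions where they
    differ from \<open>w\<close>. By \<open>sub\<close> there are at most
    \<open>B * p ^ card I\<close> of them, each confused with \<open>w\<close> for a fraction at
    most \<open>(D / N) ^ card I\<close> of the node choices; the binomial theorem sums this
    up.\<close>
  have sumL: "(\<Sum>\<tau>\<in>T. L \<tau> w) \<le> real N ^ n * \<Lambda>" if w: "w \<in> S" for w
  proof -
    define Sl where "Sl = {w'\<in>S. l w' = l w}"
    define \<Delta> where "\<Delta> w' = {t\<in>{..<n}. x w' t \<noteq> x w t}" for w'
    have finSl: "finite Sl" unfolding Sl_def using fin by simp
    have "(\<Sum>\<tau>\<in>T. L \<tau> w) = (\<Sum>\<tau>\<in>T. \<Sum>w'\<in>Sl. if obs p n F \<tau> (x w') = obs p n F \<tau> (x w) then 1 else 0)"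
    proof (rule sum.cong[OF refl])
      fix \<tau>
      have "{w'\<in>S. f \<tau> w' = f \<tau> w} = {w'\<in>Sl. obs p n F \<tau> (x w') = obs p n F \<tau> (x w)}"
        unfolding f_def Sl_def by auto
      then show "L \<tau> w = (\<Sum>w'\<in>Sl. if obs p n F \<tau> (x w') = obs p n F \<tau> (x w) then 1 else 0)"
        unfolding L_def using finSl by (simp add: sum.If_cases Int_def)
    qed
    also have "\<dots> = (\<Sum>w'\<in>Sl. real (card {\<tau>\<in>T. obs p n F \<tau> (x w') = obs p n F \<tau> (x w)}))"
      by (subst sum.swap) (simp add: sum.If_cases finT Int_def)
    also have "\<dots> \<le> (\<Sum>w'\<in>Sl. real N ^ n * (real D / real N) ^ card (\<Delta> w'))"
      unfolding T_def \<Delta>_def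
      by (intro sum_mono card_obs_agree[OF agree N]) (auto simp: Sl_def xA w)
    also have "\<dots> = (\<Sum>I\<in>Pow J. \<Sum>w'\<in>{w'\<in>Sl. \<Delta> w' = I}. real N ^ n * (real D / real N) ^ card (\<Delta> w'))"
    proof (rule sum.group[symmetric])
      show "\<Delta> ` Sl \<subseteq> Pow J" unfolding \<Delta>_def Sl_def using out w by auto
    qed (use finSl fJ in auto)
    also have "\<dots> = (\<Sum>I\<in>Pow J. real (card {w'\<in>Sl. \<Delta> w' = I}) * (real N ^ n * (real D / real N) ^ card I))"
      by (intro sum.cong refl) simp
    also have "\<dots> \<le> (\<Sum>I\<in>Pow J. (B * real p ^ card I) * (real N ^ n * (real D / real N) ^ card I))"
    proof (intro sum_mono mult_right_mono)
      fix I assume I: "I \<in> Pow J"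
      have "real (card {w'\<in>Sl. \<Delta> w' = I}) \<le> real (card {w'\<in>S. l w' = l w \<and> (\<forall>t<n. t \<notin> I \<longrightarrow> x w' t = x w t)})"
        using fin by (intro of_nat_mono card_mono) (auto simp: Sl_def \<Delta>_def)
      also have "\<dots> \<le> B * real p ^ card I" using sub[OF w] I by blast
      finally show "real (card {w'\<in>Sl. \<Delta> w' = I}) \<le> B * real p ^ card I" .
    qed simp
    also have "\<dots> = B * real N ^ n * (\<Sum>I\<in>Pow J. (real p * real D / real N) ^ card I)"
      by (simp add: sum_distrib_left power_mult_distrib power_divide mult_ac)
    also have "\<dots> = B * real N ^ n * r ^ card J"
      unfolding sum_Pow_power[OF fJ] r_def ..
    also have "\<dots> \<le> B * real N ^ n * r ^ n"
      using J B r1 card_mono[OF _ J] by (intro mult_left_mono power_increasing) auto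
    finally show ?thesis unfolding \<Lambda>_def by (simp add: mult_ac)
  qed
  define g where "g \<tau> w = d (obs p n F \<tau> (x w)) (l w)" for \<tau> w
  have g: "g \<tau> w \<ge> 0" "g \<tau> w \<le> 1" if "\<tau> \<in> T" "w \<in> S" for \<tau> w
  proof -
    have \<tau>: "\<tau> \<in> {..<n} \<rightarrow>\<^sub>E {..<N}" using that(1) by (simp only: T_def)
    show "g \<tau> w \<ge> 0" unfolding g_def by (rule d0[OF \<tau> that(2) l[OF that(2)]])
    have "g \<tau> w \<le> (\<Sum>j<m. d (obs p n F \<tau> (x w)) j)"
      unfolding g_def using l[OF that(2)] d0[OF \<tau> that(2)]
      by (intro member_le_sum[of "l w" "{..<m}" "d (obs p n F \<tau> (x w))"]) auto
    then show "g \<tau> w \<le> 1" using d1[OF \<tau> that(2)] by linarith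
  qed
  \<comment> \<open>The convex function \<open>1 / L\<close> lies above its tangent at
    \<open>2 * \<Lambda>\<close>, which is linear in \<open>L\<close>, so a bound on the mean of
    \<open>L\<close> suffices. The point \<open>2 * \<Lambda>\<close> is the mean bound
    \<open>\<Lambda>\<close> divided by the success rate one half.\<close>
  have lower: "real N ^ n / (4 * \<Lambda>) \<le> (\<Sum>\<tau>\<in>T. g \<tau> w / L \<tau> w)" if w: "w \<in> S" for w
  proof -
    have "real N ^ n / (4 * \<Lambda>) = (real N ^ n / 2) / \<Lambda> - (real N ^ n * \<Lambda>) / (4 * \<Lambda>\<^sup>2)"
      using \<Lambda> by (simp add: field_simps power2_eq_square)
    also have "\<dots> \<le> (\<Sum>\<tau>\<in>T. g \<tau> w) / \<Lambda> - (\<Sum>\<tau>\<in>T. L \<tau> w) / (4 * \<Lambda>\<^sup>2)"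
      using succ[OF w] sumL[OF w] \<Lambda> unfolding g_def T_def
      by (intro diff_mono divide_right_mono) auto
    also have "\<dots> = (\<Sum>\<tau>\<in>T. g \<tau> w / \<Lambda> - L \<tau> w / (4 * \<Lambda>\<^sup>2))"
      by (simp add: sum_subtractf sum_divide_distrib)
    also have "\<dots> \<le> (\<Sum>\<tau>\<in>T. g \<tau> w / L \<tau> w)"
    proof (rule sum_mono)
      fix \<tau> assume \<tau>: "\<tau> \<in> T"
      have "1 / L \<tau> w - (1 / \<Lambda> - L \<tau> w / (4 * \<Lambda>\<^sup>2)) = (2 * \<Lambda> - L \<tau> w)\<^sup>2 / (4 * \<Lambda>\<^sup>2 * L \<tau> w)"
        using \<Lambda> L1[OF w, of \<tau>] by (simp add: field_simps power2_eq_square)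
      also have "\<dots> \<ge> 0" using L1[OF w, of \<tau>] by simp
      finally have "g \<tau> w * (1 / \<Lambda> - L \<tau> w / (4 * \<Lambda>\<^sup>2)) \<le> g \<tau> w * (1 / L \<tau> w)"
        using g[OF \<tau> w] by (intro mult_left_mono) auto
      moreover have "g \<tau> w * (L \<tau> w / (4 * \<Lambda>\<^sup>2)) \<le> 1 * (L \<tau> w / (4 * \<Lambda>\<^sup>2))"
        using g[OF \<tau> w] L1[OF w, of \<tau>] by (intro mult_right_mono) auto
      ultimately show "g \<tau> w / \<Lambda> - L \<tau> w / (4 * \<Lambda>\<^sup>2) \<le> g \<tau> w / L \<tau> w"
        by (simp add: algebra_simps)
    qed
    finally show ?thesis .
  qed
  \<comment> \<open>For fixed nodes the weights \<open>1 / L\<close> make each pair of observation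
    and label count once, and the decoder spends at most mass 1 on each observation.\<close>
  have upper: "(\<Sum>w\<in>S. g \<tau> w / L \<tau> w) \<le> real p ^ card J" if \<tau>: "\<tau> \<in> T" for \<tau>
  proof -
    define Y where "Y = (\<lambda>w. obs p n F \<tau> (x w)) ` S"
    have "(\<Sum>w\<in>S. g \<tau> w / L \<tau> w) = (\<Sum>b\<in>f \<tau> ` S. case_prod d b)"
      using sum_div_card_fibre[OF fin, of "case_prod d" "f \<tau>"] unfolding g_def L_def f_def by simp
    also have "\<dots> \<le> (\<Sum>b\<in>Y \<times> {..<m}. case_prod d b)"
    proof (rule sum_mono2)
      show "finite (Y \<times> {..<m})" unfolding Y_def using fin by simp
      show "f \<tau> ` S \<subseteq> Y \<times> {..<m}" unfolding Y_def f_def using l by auto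
      show "0 \<le> case_prod d b" if "b \<in> Y \<times> {..<m} - f \<tau> ` S" for b
        using that d0[of \<tau>] \<tau> unfolding Y_def T_def by force
    qed
    also have "\<dots> = (\<Sum>y\<in>Y. \<Sum>j<m. d y j)" by (simp add: sum.cartesian_product)
    also have "\<dots> \<le> (\<Sum>y\<in>Y. 1)"
      using d1[of \<tau>] \<tau> unfolding Y_def T_def by (intro sum_mono) auto
    also have "\<dots> \<le> real (p ^ card J)"
      unfolding Y_def using card_obs_image[of F p J n S x \<tau>, OF F J out] by simp
    finally show ?thesis by simp
  qed
  have "real (card S) * (real N ^ n / (4 * \<Lambda>)) \<le> (\<Sum>w\<in>S. \<Sum>\<tau>\<in>T. g \<tau> w / L \<tau> w)"
    using sum_mono[OF lower, of S "\<lambda>w. w"] by simp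
  also have "\<dots> = (\<Sum>\<tau>\<in>T. \<Sum>w\<in>S. g \<tau> w / L \<tau> w)" by (rule sum.swap)
  also have "\<dots> \<le> real N ^ n * real p ^ card J"
    using sum_mono[OF upper, of T "\<lambda>w. w"] cardT by simp
  finally have "real N ^ n * (real (card S) / (4 * \<Lambda>)) \<le> real N ^ n * real p ^ card J"
    by (simp add: mult_ac)
  then have "real (card S) / (4 * \<Lambda>) \<le> real p ^ card J"
    using N by (simp add: mult_le_cancel_left_pos del: times_divide_eq_right)
  then show ?thesis using \<Lambda> unfolding \<Lambda>_def r_def by (simp add: field_simps)
qed

section \<open>The Reed-Solomon broadcast channel\<close>

text \<open>All inputs \<open>x\<close> have the same weight and fix the receivers' outputs, so
  marginals are counts and non-signalling becomes an equality of cardinalities.\<close>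

lemma ns_marg_eq_card:
  assumes "\<And>x. x \<in> xblocks nx n \<Longrightarrow> D x \<in> msgs K m"
    and Z: "\<And>x wh. x \<in> xblocks nx n \<Longrightarrow> wh \<in> msgs K m \<Longrightarrow> Z w yy x wh = (if wh = D x then c else 0)"
  shows "ns_marg K nx n m Z t S w yy x0 wh0
    = c * real (card {x\<in>xblocks nx n. (t \<longrightarrow> x = x0) \<and> (\<forall>k\<in>S. D x k = wh0 k)})"
proof -
  have "ns_marg K nx n m Z t S w yy x0 wh0
      = (\<Sum>x\<in>xblocks nx n. if (t \<longrightarrow> x = x0) \<and> (\<forall>k\<in>S. D x k = wh0 k) then c else 0)"
    unfolding ns_marg_def
  proof (rule sum.cong[OF refl])
    fix x assume x: "x \<in> xblocks nx n"
    have "(\<Sum>wh\<in>msgs K m. if (t \<longrightarrow> x = x0) \<and> (\<forall>k\<in>S. wh k = wh0 k) then Z w yy x wh else 0)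
        = (\<Sum>wh\<in>msgs K m. if wh = D x then (if (t \<longrightarrow> x = x0) \<and> (\<forall>k\<in>S. D x k = wh0 k) then c else 0) else 0)"
      using Z[OF x] by (intro sum.cong) auto
    also have "\<dots> = (if (t \<longrightarrow> x = x0) \<and> (\<forall>k\<in>S. D x k = wh0 k) then c else 0)"
      using assms(1)[OF x] card_msgs(2) by simp
    finally show "(\<Sum>wh\<in>msgs K m. if (t \<longrightarrow> x = x0) \<and> (\<forall>k\<in>S. wh k = wh0 k) then Z w yy x wh else 0)
        = (if (t \<longrightarrow> x = x0) \<and> (\<forall>k\<in>S. D x k = wh0 k) then c else 0)" .
  qed
  also have "\<dots> = c * real (card {x\<in>xblocks nx n. (t \<longrightarrow> x = x0) \<and> (\<forall>k\<in>S. D x k = wh0 k)})"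
    by (simp add: sum.If_cases card_xblocks Int_def)
  finally show ?thesis .
qed

text \<open>Bijectivity makes the receivers' outputs jointly uniform whatever the inputs, which is
  non-signalling without the transmitter; given \<open>x\<close>, each receiver's output is a function of its own input
  and message, which is non-signalling with the transmitter.\<close>
lemma ns_scheme_uniform:
  fixes d :: "nat \<Rightarrow> nat \<Rightarrow> (nat \<Rightarrow> nat) \<Rightarrow> (nat \<Rightarrow> nat) \<Rightarrow> nat"
  assumes nx: "nx \<ge> 1" and m: "\<And>k. k < K \<Longrightarrow> m k \<ge> 1"
    and D: "\<And>w yy x. D w yy x = (\<lambda>k\<in>{..<K}. d k (w k) (yy k) x)"
    and bij: "\<And>w yy. w \<in> msgs K m \<Longrightarrow> yy \<in> yblocks K ny n \<Longrightarrow> bij_betw (D w yy) (xblocks nx n) (msgs K m)"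
  shows "ns_scheme K nx ny n m (\<lambda>w yy x wh. if wh = D w yy x then 1 / real nx ^ n else 0)"
    (is "ns_scheme K nx ny n m ?Z")
proof -
  let ?c = "1 / real nx ^ n"
  have Dm: "D w yy x \<in> msgs K m" if "w \<in> msgs K m" "yy \<in> yblocks K ny n" "x \<in> xblocks nx n" for w yy x
    using bij[OF that(1,2)] that(3) by (auto simp: bij_betw_def)
  have marg: "ns_marg K nx n m ?Z t S w yy x0 wh0
      = ?c * real (card {x\<in>xblocks nx n. (t \<longrightarrow> x = x0) \<and> (\<forall>k\<in>S. D w yy x k = wh0 k)})"
    if "w \<in> msgs K m" "yy \<in> yblocks K ny n" for t S w yy x0 wh0
    by (rule ns_marg_eq_card) (use Dm that in auto)
  have total: "(\<Sum>x\<in>xblocks nx n. \<Sum>wh\<in>msgs K m. ?Z w yy x wh) = 1"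
    if "w \<in> msgs K m" "yy \<in> yblocks K ny n" for w yy
    using marg[OF that, of False "{}"] nx unfolding ns_marg_def by (simp add: card_xblocks)
  have ns: "ns_marg K nx n m ?Z t S w yy x0 wh0 = ns_marg K nx n m ?Z t S w' yy' x0 wh0"
    if S: "S \<subseteq> {..<K}" and w: "w \<in> msgs K m" "w' \<in> msgs K m"
      and y: "yy \<in> yblocks K ny n" "yy' \<in> yblocks K ny n" and eq: "t \<longrightarrow> w = w'" "\<forall>k\<in>S. yy k = yy' k"
    for t S w w' yy yy' x0 wh0
  proof (cases t)
    case True
    then have "D w yy x k = D w' yy' x k" if "k \<in> S" for x k
      using that S eq unfolding D by auto
    then show ?thesis unfolding marg[OF w(1) y(1)] marg[OF w(2) y(2)] by simp
  next
    case False
    have "card {x\<in>xblocks nx n. \<forall>k\<in>S. D w yy x k = wh0 k} = card {v\<in>msgs K m. \<forall>k\<in>S. v k = wh0 k}"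
      if "w \<in> msgs K m" "yy \<in> yblocks K ny n" for w yy
    proof (rule bij_betw_same_card)
      show "bij_betw (D w yy) {x\<in>xblocks nx n. \<forall>k\<in>S. D w yy x k = wh0 k} {v\<in>msgs K m. \<forall>k\<in>S. v k = wh0 k}"
        using bij[OF that] unfolding bij_betw_def inj_on_def by (auto simp: image_iff)
    qed
    then show ?thesis using False unfolding marg[OF w(1) y(1)] marg[OF w(2) y(2)] by (simp add: w y)
  qed
  show ?thesis unfolding ns_scheme_def
    using m total by (intro conjI) (auto intro!: ns)
qed

lemma mod_diff_cancel_nat:
  fixes a b c p :: nat
  assumes "a < p" "b < p" "(c + (p - a)) mod p = (c + (p - b)) mod p"
  shows "a = b"
proof -
  have "int p dvd int (c + (p - a)) - int (c + (p - b))"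
    using assms(3) by (metis mod_eq_dvd_iff zmod_int)
  then have "int p dvd int b - int a" using assms(1,2) by (simp add: of_nat_diff)
  then have "int b mod int p = int a mod int p" by (simp add: mod_eq_dvd_iff)
  then show ?thesis using assms(1,2) by simp
qed

section \<open>The channel, its block law and a zero-error non-signalling code\<close>

locale rs_bc =
  fixes p K N :: nat
  assumes p: "prime p" and K: "K \<ge> 1" and N: "N \<ge> 1" and KN: "K * N \<le> p"
begin

text \<open>Receiver \<open>k\<close> owns the nodes from \<open>k * N\<close> to
  \<open>k * N + N - 1\<close>. These blocks are disjoint and, by \<open>K * N \<le> p\<close>,
  consist of residues modulo \<open>p\<close>.\<close>

definition F :: "nat \<Rightarrow> nat \<Rightarrow> nat \<Rightarrow> nat" where
  "F k \<tau> x = rs_eval p K (k * N + \<tau>) x"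

text \<open>An output holds a node index in \<open>y div p\<close> and a value in
  \<open>y mod p\<close>. The node is uniform, and the product in \<open>W\<close> makes the nodes
  of different receivers independent given \<open>x\<close>.\<close>

definition V :: "nat \<Rightarrow> nat \<Rightarrow> nat \<Rightarrow> real" where
  "V k x y = (if y mod p = F k (y div p) x then 1 / real N else 0)"

definition W :: "nat \<Rightarrow> (nat \<Rightarrow> nat) \<Rightarrow> real" where
  "W x y = (\<Prod>k<K. V k x (y k))"

abbreviation "ny \<equiv> (\<lambda>_::nat. N * p)"

lemma p0: "p > 0" using p by (simp add: prime_gt_0_nat)

lemma F_less: "F k \<tau> x < p" unfolding F_def by (rule rs_eval_less[OF p])

lemma node_less: "k < K \<Longrightarrow> \<tau> < N \<Longrightarrow> k * N + \<tau> < p"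
proof -
  assume "k < K" "\<tau> < N"
  then have "k * N + \<tau> < Suc k * N" by simp
  also have "\<dots> \<le> K * N" using \<open>k < K\<close> by (intro mult_le_mono1) simp
  finally show ?thesis using KN by linarith
qed

text \<open>One node from each of \<open>K\<close> disjoint blocks yields \<open>K\<close> distinct
  interpolation points.\<close>

lemma F_inj:
  assumes "\<And>k. k < K \<Longrightarrow> \<tau> k < N" "x < p ^ K" "y < p ^ K" "\<And>k. k < K \<Longrightarrow> F k (\<tau> k) x = F k (\<tau> k) y"
  shows "x = y"
proof (rule rs_eval_inj[OF p])
  let ?T = "(\<lambda>k. k * N + \<tau> k) ` {..<K}"
  show "?T \<subseteq> {..<p}" using node_less assms(1) by auto
  have "inj_on (\<lambda>k. k * N + \<tau> k) {..<K}"
  proof (rule inj_onI)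
    fix k k' assume *: "k \<in> {..<K}" "k' \<in> {..<K}" "k * N + \<tau> k = k' * N + \<tau> k'"
    moreover have "(i * N + \<tau> i) div N = i" if "i < K" for i using assms(1)[OF that] by simp
    ultimately show "k = k'" by (metis lessThan_iff)
  qed
  then show "K \<le> card ?T" by (simp add: card_image)
  show "rs_eval p K t x = rs_eval p K t y" if "t \<in> ?T" for t
    using that assms(4) unfolding F_def by auto
qed (use assms in auto)

text \<open>\<open>K\<close> agreements inside a single block would already force equality by
  interpolation.\<close>

lemma F_agree:
  assumes k: "k < K" and x: "x < p ^ K" "y < p ^ K" "x \<noteq> y"
  shows "card {\<tau>\<in>{..<N}. F k \<tau> x = F k \<tau> y} \<le> K - 1"
proof (rule ccontr)
  let ?S = "{\<tau>\<in>{..<N}. F k \<tau> x = F k \<tau> y}"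
  assume "\<not> ?thesis"
  then have "K \<le> card ((\<lambda>\<tau>. k * N + \<tau>) ` ?S)" by (simp add: card_image)
  then have "x = y"
    using node_less[OF k] by (intro rs_eval_inj[OF p _ _ x(1,2)]) (auto simp: F_def)
  then show False using x by simp
qed

lemma obs_in_yblock:
  assumes "\<tau> \<in> {..<n} \<rightarrow>\<^sub>E {..<N}"
  shows "obs p n (F k) \<tau> x \<in> yblock (N * p) n"
proof -
  have "\<tau> t * p + F k (\<tau> t) (x t) < N * p" if "t < n" for t
  proof -
    have "\<tau> t * p + F k (\<tau> t) (x t) < Suc (\<tau> t) * p" using F_less by simp
    also have "\<dots> \<le> N * p" using assms that by (intro mult_le_mono1) (auto simp: PiE_iff Suc_le_eq)
    finally show ?thesis .
  qed
  then show ?thesis unfolding obs_def yblock_def by auto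
qed

text \<open>The output blocks of positive probability are those of the form \<open>obs\<close>; each
  comes from one node sequence and has probability \<open>1 / N ^ n\<close>. Averages over outputs
  thus become averages over nodes.\<close>

lemma sum_Vn:
  "(\<Sum>y\<in>yblock (N * p) n. (\<Prod>t<n. V k (x t) (y t)) * g y)
   = (\<Sum>\<tau>\<in>{..<n} \<rightarrow>\<^sub>E {..<N}. g (obs p n (F k) \<tau> x)) / real N ^ n"
proof -
  let ?T = "{..<n} \<rightarrow>\<^sub>E {..<N}" and ?o = "\<lambda>\<tau>. obs p n (F k) \<tau> x"
  have div: "?o \<tau> t div p = \<tau> t" and mod: "?o \<tau> t mod p = F k (\<tau> t) (x t)" if "t < n" for \<tau> t
    using that F_less[of k "\<tau> t" "x t"] by (auto simp: obs_def)
  have inj: "inj_on ?o ?T"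
  proof (rule inj_onI, rule PiE_ext)
    fix \<tau> \<tau>' t assume "\<tau> \<in> ?T" "\<tau>' \<in> ?T" "?o \<tau> = ?o \<tau>'" "t \<in> {..<n}"
    then show "\<tau> t = \<tau>' t" by (metis div lessThan_iff)
  qed
  have "(\<Sum>y\<in>yblock (N * p) n. (\<Prod>t<n. V k (x t) (y t)) * g y)
      = (\<Sum>y\<in>?o ` ?T. (\<Prod>t<n. V k (x t) (y t)) * g y)"
  proof (rule sum.mono_neutral_right)
    show "?o ` ?T \<subseteq> yblock (N * p) n" using obs_in_yblock by blast
    show "\<forall>y\<in>yblock (N * p) n - ?o ` ?T. (\<Prod>t<n. V k (x t) (y t)) * g y = 0"
    proof
      fix y assume y: "y \<in> yblock (N * p) n - ?o ` ?T"
      have "\<exists>t<n. V k (x t) (y t) = 0"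
      proof (rule ccontr)
        assume "\<not> ?thesis"
        then have *: "y t mod p = F k (y t div p) (x t)" if "t < n" for t
          using that unfolding V_def by (metis)
        let ?\<tau> = "\<lambda>t\<in>{..<n}. y t div p"
        have "?\<tau> \<in> ?T" using y p0 by (auto simp: yblock_def PiE_iff less_mult_imp_div_less)
        moreover have "y = ?o ?\<tau>"
        proof (rule PiE_ext[of _ "{..<n}" "\<lambda>_. {..<N * p}"])
          show "y \<in> {..<n} \<rightarrow>\<^sub>E {..<N * p}" using y unfolding yblock_def by blast
          show "?o ?\<tau> \<in> {..<n} \<rightarrow>\<^sub>E {..<N * p}"
            using obs_in_yblock[OF \<open>?\<tau> \<in> ?T\<close>] unfolding yblock_def by blast
          show "y t = ?o ?\<tau> t" if "t \<in> {..<n}" for t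
            using that *[of t] by (simp add: obs_def) (metis div_mult_mod_eq)
        qed
        ultimately show False using y by blast
      qed
      then show "(\<Prod>t<n. V k (x t) (y t)) * g y = 0" by auto
    qed
  qed (rule finite_yblock)
  also have "\<dots> = (\<Sum>\<tau>\<in>?T. (\<Prod>t<n. V k (x t) (?o \<tau> t)) * g (?o \<tau>))"
    by (simp add: sum.reindex[OF inj])
  also have "\<dots> = (\<Sum>\<tau>\<in>?T. g (?o \<tau>) / real N ^ n)"
  proof (rule sum.cong[OF refl])
    fix \<tau>
    have "(\<Prod>t<n. V k (x t) (?o \<tau> t)) = (\<Prod>t<n. 1 / real N)"
      by (intro prod.cong refl) (simp add: V_def div mod)
    then show "(\<Prod>t<n. V k (x t) (?o \<tau> t)) * g (?o \<tau>) = g (?o \<tau>) / real N ^ n"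
      by (simp add: power_divide)
  qed
  finally show ?thesis by (simp add: sum_divide_distrib)
qed

lemma sum_Vn_1: "(\<Sum>y\<in>yblock (N * p) n. (\<Prod>t<n. V k (x t) (y t))) = 1"
  using sum_Vn[where g = "\<lambda>_. 1"] N by (simp add: card_PiE)

lemma chan_n_W: "chan_n W K n x yy = (\<Prod>k<K. \<Prod>t<n. V k (x t) (yy k t))"
  unfolding chan_n_def W_def by (subst prod.swap) simp

text \<open>Given \<open>x\<close> the block law factors over the receivers, and every factor other
  than the one of \<open>k\<close> sums to 1.\<close>

lemma marginal:
  assumes k: "k < K"
  shows "(\<Sum>yy\<in>yblocks K ny n. chan_n W K n x yy * g (yy k))
    = (\<Sum>\<tau>\<in>{..<n} \<rightarrow>\<^sub>E {..<N}. g (obs p n (F k) \<tau> x)) / real N ^ n"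
proof -
  define h where "h i y = (\<Prod>t<n. V i (x t) (y t)) * (if i = k then g y else 1)" for i y
  have "(\<Sum>yy\<in>yblocks K ny n. chan_n W K n x yy * g (yy k)) = (\<Sum>yy\<in>yblocks K ny n. \<Prod>i<K. h i (yy i))"
    unfolding h_def chan_n_W prod.distrib using k by simp
  also have "\<dots> = (\<Prod>i<K. \<Sum>y\<in>yblock (N * p) n. h i y)"
    unfolding yblocks_def by (rule prod_sum_PiE[symmetric]) (auto intro: finite_yblock)
  also have "\<dots> = (\<Prod>i<K. if i = k then (\<Sum>\<tau>\<in>{..<n} \<rightarrow>\<^sub>E {..<N}. g (obs p n (F k) \<tau> x)) / real N ^ n else 1)"
    unfolding h_def using N by (intro prod.cong refl) (simp add: sum_Vn sum_Vn_1 card_PiE)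
  also have "\<dots> = (\<Sum>\<tau>\<in>{..<n} \<rightarrow>\<^sub>E {..<N}. g (obs p n (F k) \<tau> x)) / real N ^ n"
    using k by simp
  finally show ?thesis .
qed

lemma sum_V: "(\<Sum>y<N * p. V k x y) = 1"
proof -
  have "(\<Sum>y<N * p. V k x y) = (\<Sum>m<N. \<Sum>y\<in>{m * p..<m * p + p}. V k x y)"
    by (rule sum.nat_group[symmetric])
  also have "\<dots> = (\<Sum>m<N. 1 / real N)"
  proof (rule sum.cong[OF refl])
    fix m
    have *: "y div p = m \<and> y mod p = y - m * p" if "y \<in> {m * p..<m * p + p}" for y
    proof -
      have "y = m * p + (y - m * p)" "y - m * p < p" using that by auto
      then show ?thesis by (metis add_cancel_left_right div_less div_mult_self3 mod_less mod_mult_self3 not_less0 p0 gr_implies_not0)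
    qed
    have "(\<Sum>y\<in>{m * p..<m * p + p}. V k x y)
        = (\<Sum>y\<in>{m * p..<m * p + p}. if y = m * p + F k m x then 1 / real N else 0)"
      using * by (intro sum.cong refl) (auto simp: V_def)
    also have "\<dots> = 1 / real N" using F_less[of k m x] by simp
    finally show "(\<Sum>y\<in>{m * p..<m * p + p}. V k x y) = 1 / real N" .
  qed
  also have "\<dots> = 1" using N by simp
  finally show ?thesis .
qed

lemma is_dm_bc: "is_dm_bc K (p ^ K) ny W"
proof -
  have "(\<Sum>y\<in>outs K ny. W x y) = 1" for x
  proof -
    have "(\<Sum>y\<in>outs K ny. W x y) = (\<Prod>k<K. \<Sum>y<N * p. V k x y)"
      unfolding outs_def W_def by (rule prod_sum_PiE[symmetric]) auto
    then show ?thesis by (simp add: sum_V)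
  qed
  moreover have "W x y \<ge> 0" for x y unfolding W_def V_def by (intro prod_nonneg) simp
  moreover have "p ^ K \<ge> 1" "N * p \<ge> 1" using p0 N by (simp_all add: Suc_le_eq)
  ultimately show ?thesis unfolding is_dm_bc_def by simp
qed

text \<open>In each position the box gives receiver \<open>k\<close> the message symbol plus the
  received value minus the value of its own \<open>x\<close> at the reported node. Over the channel
  the two values coincide and the message comes back. For arbitrary inputs the outputs are uniform,
  since \<open>x\<close> corresponds bijectively to its values at \<open>K\<close> nodes.\<close>

lemma ns_zero_error:
  "\<exists>Z. ns_scheme K (p ^ K) ny n (\<lambda>_. p ^ n) Z \<and> (\<forall>k<K. ns_err K (p ^ K) ny W n (\<lambda>_. p ^ n) Z k = 0)"
proof -
  let ?B = "{..<n} \<rightarrow>\<^sub>E {..<p}"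
  \<comment> \<open>Messages are rewritten as words of \<open>n\<close> symbols modulo
    \<open>p\<close>, so that they can be masked symbol by symbol.\<close>
  have "card {..<p ^ n} = card ?B" by (simp add: card_PiE)
  then obtain \<phi> where \<phi>: "bij_betw \<phi> {..<p ^ n} ?B"
    using finite_same_card_bij[of "{..<p ^ n}" ?B] by (auto intro: finite_PiE)
  define \<psi> where "\<psi> = inv_into {..<p ^ n} \<phi>"
  have \<psi>: "bij_betw \<psi> ?B {..<p ^ n}" unfolding \<psi>_def by (rule bij_betw_inv_into[OF \<phi>])
  \<comment> \<open>Adding \<open>p - F k\<close> is subtraction modulo \<open>p\<close>; nothing is
    truncated because \<open>F k\<close> stays below \<open>p\<close>.\<close>
  define c where "c k w y x = (\<lambda>t\<in>{..<n}. (y t mod p + \<phi> w t + (p - F k (y t div p) (x t))) mod p)"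
    for k :: nat and w :: nat and y x :: "nat \<Rightarrow> nat"
  have cB: "c k w y x \<in> ?B" for k w y x unfolding c_def using p0 by auto
  define d where "d k w y x = \<psi> (c k w y x)" for k w y x
  define D where "D w yy x = (\<lambda>k\<in>{..<K}. d k (w k) (yy k) x)" for w yy x
  have bij: "bij_betw (D w yy) (xblocks (p ^ K) n) (msgs K (\<lambda>_. p ^ n))"
    if "w \<in> msgs K (\<lambda>_. p ^ n)" and yy: "yy \<in> yblocks K ny n" for w yy
  proof -
    have inj: "inj_on (D w yy) (xblocks (p ^ K) n)"
    proof (rule inj_onI)
      fix x x' assume x: "x \<in> xblocks (p ^ K) n" "x' \<in> xblocks (p ^ K) n" and eq: "D w yy x = D w yy x'"
      show "x = x'"
      proof (rule PiE_ext)
        show "x \<in> {..<n} \<rightarrow>\<^sub>E {..<p ^ K}" "x' \<in> {..<n} \<rightarrow>\<^sub>E {..<p ^ K}"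
          using x unfolding xblocks_def by auto
        fix t assume t: "t \<in> {..<n}"
        show "x t = x' t"
        proof (rule F_inj[where \<tau> = "\<lambda>k. yy k t div p"])
          fix k assume k: "k < K"
          have "yy k t < N * p" using yy k t unfolding yblocks_def yblock_def by auto
          then show "yy k t div p < N" by (simp add: less_mult_imp_div_less)
          have "\<psi> (c k (w k) (yy k) x) = \<psi> (c k (w k) (yy k) x')"
            using fun_cong[OF eq, of k] k unfolding D_def d_def by simp
          then have "c k (w k) (yy k) x = c k (w k) (yy k) x'"
            by (rule inj_onD[OF bij_betw_imp_inj_on[OF \<psi>]]) (rule cB)+
          then have "(yy k t mod p + \<phi> (w k) t + (p - F k (yy k t div p) (x t))) mod p
              = (yy k t mod p + \<phi> (w k) t + (p - F k (yy k t div p) (x' t))) mod p"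
            using t unfolding c_def by (auto dest: fun_cong[where x = t])
          then show "F k (yy k t div p) (x t) = F k (yy k t div p) (x' t)"
            by (rule mod_diff_cancel_nat[OF F_less F_less])
        qed (use x t in \<open>auto simp: xblocks_def\<close>)
      qed
    qed
    moreover have sub: "D w yy ` xblocks (p ^ K) n \<subseteq> msgs K (\<lambda>_. p ^ n)"
      using \<psi> cB unfolding D_def d_def msgs_def bij_betw_def by fastforce
    \<comment> \<open>Both sides have \<open>p ^ (K * n)\<close> elements, which upgrades
      injectivity to bijectivity.\<close>
    moreover have "card (D w yy ` xblocks (p ^ K) n) = card (msgs K (\<lambda>_. p ^ n))"
      using inj by (simp add: card_image card_xblocks card_msgs mult.commute flip: power_mult)
    ultimately show ?thesis
      unfolding bij_betw_def using card_subset_eq[OF card_msgs(2) sub] by blast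
  qed
  define Z where "Z = (\<lambda>w yy x wh. if wh = D w yy x then 1 / real (p ^ K) ^ n else 0)"
  have "ns_scheme K (p ^ K) ny n (\<lambda>_. p ^ n) Z"
    unfolding Z_def
    by (rule ns_scheme_uniform[where d = d and D = D]) (use p0 bij in \<open>auto simp: D_def Suc_le_eq\<close>)
  moreover have "ns_err K (p ^ K) ny W n (\<lambda>_. p ^ n) Z k = 0" if k: "k < K" for k
  proof -
    have "Z w yy x wh * chan_n W K n x yy = 0"
      if w: "w \<in> msgs K (\<lambda>_. p ^ n)" and ne: "wh k \<noteq> w k" for w yy x wh
    proof (rule ccontr)
      assume "Z w yy x wh * chan_n W K n x yy \<noteq> 0"
      then have wh: "wh = D w yy x" and ch: "chan_n W K n x yy \<noteq> 0"
        unfolding Z_def by (auto split: if_splits)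
      have wk: "w k < p ^ n" using w k unfolding msgs_def by auto
      then have \<phi>w: "\<phi> (w k) \<in> ?B" using \<phi> unfolding bij_betw_def by auto
      have "c k (w k) (yy k) x = \<phi> (w k)"
      proof (rule PiE_ext[OF cB \<phi>w])
        fix t assume t: "t \<in> {..<n}"
        have "V k (x t) (yy k t) \<noteq> 0" using ch t k unfolding chan_n_W by simp
        then have "yy k t mod p = F k (yy k t div p) (x t)" unfolding V_def by (auto split: if_splits)
        then have "c k (w k) (yy k) x t = (\<phi> (w k) t + p) mod p"
          using t F_less[of k "yy k t div p" "x t"] unfolding c_def by (simp add: add_ac)
        also have "\<dots> = \<phi> (w k) t" using PiE_mem[OF \<phi>w t] by simp
        finally show "c k (w k) (yy k) x t = \<phi> (w k) t" .
      qed
      then have "wh k = w k"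
        unfolding wh D_def d_def \<psi>_def using k wk \<phi> by (simp add: bij_betw_inv_into_left)
      then show False using ne by simp
    qed
    then show ?thesis unfolding ns_err_def mult_eq_0_iff by (intro disjI2 sum.neutral ballI) auto
  qed
  ultimately show ?thesis by blast
qed

end

section \<open>Classical converse and non-signalling rates for this channel\<close>

context rs_bc
begin

text \<open>Bounded in \<open>p\<close> when \<open>N = p div K\<close>, so that \<open>log p\<close> dominates \<open>K * log r\<close> for large \<open>p\<close>.\<close>
definition r :: real where "r = 1 + real p * real (K - 1) / real N"

lemma r_ge_1: "r \<ge> 1" unfolding r_def by simp

text \<open>The peeling induction: in \<open>S\<close> the messages of receivers below
  \<open>j\<close> are fixed and codewords vary only inside \<open>J\<close>. Using receiver
  \<open>j\<close> as list decoder requires a bound for classes that also fix its message and vary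
  inside some \<open>J' \<subseteq> J\<close>, which is the same claim for \<open>Suc j\<close>.
  Each receiver costs a factor \<open>4 * r ^ n\<close>.\<close>

lemma card_decodable_le:
  assumes dec: "\<And>k y. k < K \<Longrightarrow> y \<in> yblock (N * p) n \<Longrightarrow> (\<forall>j<m k. dec k y j \<ge> 0) \<and> (\<Sum>j<m k. dec k y j) = 1"
    and "j \<le> K" "S \<subseteq> msgs K m" "J \<subseteq> {..<n}"
    and "\<And>w. w \<in> S \<Longrightarrow> x w \<in> xblocks (p ^ K) n"
    and "\<And>w k. w \<in> S \<Longrightarrow> k < K \<Longrightarrow>
       (\<Sum>\<tau>\<in>{..<n} \<rightarrow>\<^sub>E {..<N}. dec k (obs p n (F k) \<tau> (x w)) (w k)) \<ge> real N ^ n / 2"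
    and "\<And>w w' k. w \<in> S \<Longrightarrow> w' \<in> S \<Longrightarrow> k < j \<Longrightarrow> w k = w' k"
    and "\<And>w w' t. w \<in> S \<Longrightarrow> w' \<in> S \<Longrightarrow> t < n \<Longrightarrow> t \<notin> J \<Longrightarrow> x w t = x w' t"
  shows "real (card S) \<le> (4 * r ^ n) ^ (K - j) * real p ^ card J"
  using assms(2-)
proof (induction "K - j" arbitrary: j S J)
  case 0
  then have "j = K" by simp
  have "w = w'" if "w \<in> S" "w' \<in> S" for w w'
  proof (rule PiE_ext)
    show "w \<in> (\<Pi>\<^sub>E k\<in>{..<K}. {..<m k})" "w' \<in> (\<Pi>\<^sub>E k\<in>{..<K}. {..<m k})"
      using 0(3) that unfolding msgs_def by auto
  qed (use 0(7) that \<open>j = K\<close> in auto)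
  then have "card S \<le> 1"
    using finite_subset[OF 0(3) card_msgs(2)] by (simp add: card_le_Suc0_iff_eq)
  also have "1 \<le> p ^ card J" using p0 by (simp add: Suc_le_eq)
  finally show ?case using \<open>j = K\<close> by (simp flip: of_nat_power)
next
  case (Suc i)
  have j: "j < K" using Suc.hyps(2) by simp
  let ?B = "(4 * r ^ n) ^ (K - Suc j)"
  have "real (card S) \<le> 4 * ?B * (1 + real p * real (K - 1) / real N) ^ n * real p ^ card J"
  proof (rule list_decoding_bound[where F = "F j" and l = "\<lambda>w. w j" and d = "dec j" and x = x
        and A = "{..<p ^ K}" and m = "m j"])
    show "finite S" using finite_subset[OF Suc.prems(2) card_msgs(2)] .
    show "?B \<ge> 0" using r_ge_1 by simp
    show "F j \<sigma> a < p" for \<sigma> a by (rule F_less)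
    show "card {\<tau>\<in>{..<N}. F j \<tau> a = F j \<tau> b} \<le> K - 1"
      if "a \<in> {..<p ^ K}" "b \<in> {..<p ^ K}" "a \<noteq> b" for a b
      using F_agree[OF j] that by auto
    show "x w t \<in> {..<p ^ K}" if "w \<in> S" "t < n" for w t
      using Suc.prems(4)[OF that(1)] that(2) unfolding xblocks_def by auto
    show "dec j (obs p n (F j) \<tau> (x w)) i \<ge> 0"
      if "\<tau> \<in> {..<n} \<rightarrow>\<^sub>E {..<N}" "i < m j" for \<tau> w i
      using dec[OF j obs_in_yblock[OF that(1)]] that(2) by blast
    show "(\<Sum>i<m j. dec j (obs p n (F j) \<tau> (x w)) i) \<le> 1" if "\<tau> \<in> {..<n} \<rightarrow>\<^sub>E {..<N}" for \<tau> w
      using dec[OF j obs_in_yblock[OF that(1)]] by (metis order_refl)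
    show "w j < m j" if "w \<in> S" for w
      using Suc.prems(2) that j unfolding msgs_def by auto
    show "real N ^ n / 2 \<le> (\<Sum>\<tau>\<in>{..<n} \<rightarrow>\<^sub>E {..<N}. dec j (obs p n (F j) \<tau> (x w)) (w j))"
      if "w \<in> S" for w
      using Suc.prems(5)[OF that j] .
    show "x w t = x w' t" if "w \<in> S" "w' \<in> S" "t < n" "t \<notin> J" for w w' t
      using Suc.prems(7) that .
    show "real (card {w'\<in>S. w' j = w j \<and> (\<forall>t<n. t \<notin> J' \<longrightarrow> x w' t = x w t)})
        \<le> ?B * real p ^ card J'" if "w \<in> S" "J' \<subseteq> J" for w J'
    proof (rule Suc.hyps(1))
      show "i = K - Suc j" "Suc j \<le> K" using Suc.hyps(2) by auto
      show "J' \<subseteq> {..<n}" using that(2) Suc.prems(3) by blast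
    qed (use Suc.prems in \<open>auto simp: less_Suc_eq\<close>)
  qed (use N Suc.prems in auto)
  also have "\<dots> = (4 * r ^ n) ^ (K - j) * real p ^ card J"
    using j by (simp add: r_def Suc_diff_Suc[symmetric])
  finally show ?case .
qed

text \<open>By Markov's inequality: a tuple without a codeword that every receiver decodes with
  probability one half has error at least 1/2 summed over receivers. As the mean of that sum is at
  most 1/4, at least half of the tuples are good, and picking one codeword for each makes the
  encoder deterministic.\<close>

lemma classical_converse:
  assumes sch: "classical_scheme K (p ^ K) ny n m enc dec"
    and err: "\<And>k. k < K \<Longrightarrow> classical_err K (p ^ K) ny W n m enc dec k \<le> 1 / (4 * real K)"
  shows "real (\<Prod>k<K. m k) \<le> 2 * (4 * r ^ n) ^ K * real p ^ n"
proof -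
  let ?T = "{..<n} \<rightarrow>\<^sub>E {..<N}" and ?X = "xblocks (p ^ K) n"
  define M where "M = (\<Prod>k<K. m k)"
  have mpos: "m k \<ge> 1" if "k < K" for k using sch that unfolding classical_scheme_def by blast
  then have Mpos: "M > 0" unfolding M_def by (intro prod_pos) (auto simp: Suc_le_eq)
  have enc: "(\<forall>x\<in>?X. enc w x \<ge> 0) \<and> (\<Sum>x\<in>?X. enc w x) = 1" if "w \<in> msgs K m" for w
    using sch that unfolding classical_scheme_def by blast
  have dec: "(\<forall>j<m k. dec k y j \<ge> 0) \<and> (\<Sum>j<m k. dec k y j) = 1" if "k < K" "y \<in> yblock (N * p) n" for k y
    using sch that unfolding classical_scheme_def by blast
  define s where "s k w x = (\<Sum>\<tau>\<in>?T. dec k (obs p n (F k) \<tau> x) (w k)) / real N ^ n" for k w x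
  have wk: "w k < m k" if "w \<in> msgs K m" "k < K" for w k using that unfolding msgs_def by auto
  have Nn: "real N ^ n > 0" using N by simp
  have s_err: "(\<Sum>yy\<in>yblocks K ny n. enc w x * chan_n W K n x yy * (\<Sum>j\<in>{..<m k} - {w k}. dec k (yy k) j))
      = enc w x * (1 - s k w x)" if w: "w \<in> msgs K m" and k: "k < K" for w x k
  proof -
    have "(\<Sum>yy\<in>yblocks K ny n. chan_n W K n x yy * (\<Sum>j\<in>{..<m k} - {w k}. dec k (yy k) j))
        = (\<Sum>\<tau>\<in>?T. \<Sum>j\<in>{..<m k} - {w k}. dec k (obs p n (F k) \<tau> x) j) / real N ^ n"
      by (rule marginal[OF k])
    also have "(\<Sum>\<tau>\<in>?T. \<Sum>j\<in>{..<m k} - {w k}. dec k (obs p n (F k) \<tau> x) j)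
        = (\<Sum>\<tau>\<in>?T. 1 - dec k (obs p n (F k) \<tau> x) (w k))"
    proof (rule sum.cong[OF refl])
      fix \<tau> assume "\<tau> \<in> ?T"
      then show "(\<Sum>j\<in>{..<m k} - {w k}. dec k (obs p n (F k) \<tau> x) j) = 1 - dec k (obs p n (F k) \<tau> x) (w k)"
        using dec[OF k obs_in_yblock] wk[OF w k] by (simp add: sum_diff1)
    qed
    also have "\<dots> / real N ^ n = 1 - s k w x"
      unfolding s_def using N by (simp add: sum_subtractf card_PiE diff_divide_distrib)
    finally show ?thesis by (simp add: mult.assoc flip: sum_distrib_left)
  qed
  have err_eq: "classical_err K (p ^ K) ny W n m enc dec k
      = (1 / real M) * (\<Sum>w\<in>msgs K m. \<Sum>x\<in>?X. enc w x * (1 - s k w x))" if "k < K" for k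
    unfolding classical_err_def M_def using s_err[OF _ that] by (simp cong: sum.cong)
  have s_le: "s k w x \<le> 1" if w: "w \<in> msgs K m" and k: "k < K" for k w x
  proof -
    have "(\<Sum>\<tau>\<in>?T. dec k (obs p n (F k) \<tau> x) (w k)) \<le> (\<Sum>\<tau>\<in>?T. 1)"
    proof (rule sum_mono)
      fix \<tau> assume "\<tau> \<in> ?T"
      note d = dec[OF k obs_in_yblock[OF this, of k x]]
      have "dec k (obs p n (F k) \<tau> x) (w k) \<le> (\<Sum>j<m k. dec k (obs p n (F k) \<tau> x) j)"
        using d wk[OF w k] by (intro member_le_sum) auto
      then show "dec k (obs p n (F k) \<tau> x) (w k) \<le> 1" using d by simp
    qed
    then show ?thesis unfolding s_def using Nn by (simp add: card_PiE)
  qed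
  define G where "G = {w\<in>msgs K m. \<exists>x\<in>?X. \<forall>k<K. s k w x \<ge> 1 / 2}"
  have G: "G \<subseteq> msgs K m" unfolding G_def by blast
  have bad: "1 / 2 \<le> (\<Sum>k<K. \<Sum>x\<in>?X. enc w x * (1 - s k w x))" if w: "w \<in> msgs K m - G" for w
  proof -
    have "1 / 2 = (\<Sum>x\<in>?X. enc w x * (1 / 2))"
      using enc[of w] w by (simp flip: sum_divide_distrib)
    also have "\<dots> \<le> (\<Sum>x\<in>?X. enc w x * (\<Sum>k<K. 1 - s k w x))"
    proof (intro sum_mono mult_left_mono)
      fix x assume x: "x \<in> ?X"
      obtain k where k: "k < K" "s k w x < 1 / 2" using w x unfolding G_def by force
      have "1 - s k w x \<le> (\<Sum>k<K. 1 - s k w x)"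
        using k s_le w by (intro member_le_sum) auto
      then show "1 / 2 \<le> (\<Sum>k<K. 1 - s k w x)" using k by linarith
    qed (use enc w in auto)
    also have "\<dots> = (\<Sum>k<K. \<Sum>x\<in>?X. enc w x * (1 - s k w x))"
      unfolding sum_distrib_left by (rule sum.swap)
    finally show ?thesis .
  qed
  have nonneg: "0 \<le> (\<Sum>k<K. \<Sum>x\<in>?X. enc w x * (1 - s k w x))" if "w \<in> msgs K m" for w
    using enc s_le that by (intro sum_nonneg mult_nonneg_nonneg) auto
  have "real (card (msgs K m - G)) * (1 / 2) \<le> (\<Sum>w\<in>msgs K m - G. \<Sum>k<K. \<Sum>x\<in>?X. enc w x * (1 - s k w x))"
    using sum_mono[OF bad, of "msgs K m - G" "\<lambda>w. w"] by simp
  also have "\<dots> \<le> (\<Sum>w\<in>msgs K m. \<Sum>k<K. \<Sum>x\<in>?X. enc w x * (1 - s k w x))"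
    using nonneg by (intro sum_mono2) (auto simp: card_msgs)
  also have "\<dots> = (\<Sum>k<K. real M * classical_err K (p ^ K) ny W n m enc dec k)"
    using Mpos by (subst sum.swap) (simp add: err_eq)
  also have "\<dots> \<le> (\<Sum>k<K. real M * (1 / (4 * real K)))"
    using err by (intro sum_mono mult_left_mono) auto
  also have "\<dots> = real M / 4" using K by simp
  finally have "real (card (msgs K m - G)) \<le> real M / 2" by simp
  moreover have "card (msgs K m) = card G + card (msgs K m - G)"
    using G card_msgs(2) finite_subset[OF G] by (simp add: card_Diff_subset card_mono)
  ultimately have MG: "real M \<le> 2 * real (card G)"
    by (simp add: card_msgs flip: M_def)
  have "\<forall>w\<in>G. \<exists>x. x \<in> ?X \<and> (\<forall>k<K. s k w x \<ge> 1 / 2)" unfolding G_def by blast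
  then obtain x where x: "\<And>w. w \<in> G \<Longrightarrow> x w \<in> ?X" "\<And>w k. w \<in> G \<Longrightarrow> k < K \<Longrightarrow> s k w (x w) \<ge> 1 / 2"
    by metis
  have "real (card G) \<le> (4 * r ^ n) ^ (K - 0) * real p ^ card {..<n}"
  proof (rule card_decodable_le[where x = x and dec = dec and m = m])
    show "real N ^ n / 2 \<le> (\<Sum>\<tau>\<in>?T. dec k (obs p n (F k) \<tau> (x w)) (w k))" if "w \<in> G" "k < K" for w k
      using x(2)[OF that] Nn unfolding s_def by (simp add: field_simps)
  qed (use G x(1) dec in auto)
  then show ?thesis using MG unfolding M_def by simp
qed

text \<open>After taking logarithms in \<open>classical_converse\<close> and dividing by
  \<open>n\<close>, the constant \<open>2 * 4 ^ K\<close> contributes only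
  \<open>(1 + 2 * K) / n\<close>.\<close>

lemma achievable_C_sum_le:
  assumes "achievable_C K (p ^ K) ny W R"
  shows "(\<Sum>k<K. R k) \<le> log 2 p + K * log 2 r"
proof -
  from assms obtain m enc dec where
    sch: "\<And>n. classical_scheme K (p ^ K) ny n (m n) (enc n) (dec n)"
    and lim: "(\<lambda>n. Max ((\<lambda>k. classical_err K (p ^ K) ny W n (m n) (enc n) (dec n) k) ` {..<K})) \<longlonglongrightarrow> 0"
    and rate: "\<forall>k<K. \<exists>L. (\<lambda>n. log 2 (real (m n k)) / real n) \<longlonglongrightarrow> L \<and> L \<ge> R k"
    unfolding achievable_C_def by blast
  from rate obtain L where L: "\<And>k. k < K \<Longrightarrow> (\<lambda>n. log 2 (real (m n k)) / real n) \<longlonglongrightarrow> L k"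
    "\<And>k. k < K \<Longrightarrow> L k \<ge> R k" by metis
  have lim2: "(\<lambda>n. \<Sum>k<K. log 2 (real (m n k)) / real n) \<longlonglongrightarrow> (\<Sum>k<K. L k)"
    by (intro tendsto_sum L) simp
  have "(\<lambda>n. (1 + 2 * real K) / real n + (K * log 2 r + log 2 p)) \<longlonglongrightarrow> 0 + (K * log 2 r + log 2 p)"
    by (intro tendsto_intros lim_const_over_n)
  moreover have "\<forall>\<^sub>F n in sequentially. (\<Sum>k<K. log 2 (real (m n k)) / real n)
      \<le> (1 + 2 * real K) / real n + (K * log 2 r + log 2 p)"
  proof -
    have "\<forall>\<^sub>F n in sequentially. Max ((\<lambda>k. classical_err K (p ^ K) ny W n (m n) (enc n) (dec n) k) ` {..<K}) < 1 / (4 * real K)"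
      using lim K by (intro order_tendstoD(2)) auto
    then show ?thesis using eventually_gt_at_top[of 0]
    proof eventually_elim
      case (elim n)
      have mpos: "m n k > 0" if "k < K" for k
        using sch[of n] that unfolding classical_scheme_def by (auto simp: Suc_le_eq)
      have "real (\<Prod>k<K. m n k) \<le> 2 * (4 * r ^ n) ^ K * real p ^ n"
      proof (rule classical_converse[OF sch])
        fix k assume "k < K"
        then have "classical_err K (p ^ K) ny W n (m n) (enc n) (dec n) k
            \<le> Max ((\<lambda>k. classical_err K (p ^ K) ny W n (m n) (enc n) (dec n) k) ` {..<K})"
          by (intro Max_ge) auto
        then show "classical_err K (p ^ K) ny W n (m n) (enc n) (dec n) k \<le> 1 / (4 * real K)"
          using elim by linarith
      qed
      then have "log 2 (real (\<Prod>k<K. m n k)) \<le> log 2 (2 * (4 * r ^ n) ^ K * real p ^ n)"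
        using mpos r_ge_1 p0 by (subst log_le_cancel_iff) (auto intro!: prod_pos mult_pos_pos)
      also have "\<dots> = 1 + K * (log 2 4 + n * log 2 r) + n * log 2 p"
        using r_ge_1 p0 by (simp add: log_mult log_nat_power distrib_left)
      also have "log 2 4 = (2::real)" using log_pow_cancel[of "2::real" 2] by simp
      also have "log 2 (real (\<Prod>k<K. m n k)) = (\<Sum>k<K. log 2 (real (m n k)))"
        using mpos by (subst of_nat_prod, unfold log_def, subst ln_prod) (auto simp: sum_divide_distrib)
      finally show ?case
        using elim by (simp add: field_simps flip: sum_divide_distrib)
    qed
  qed
  ultimately have "(\<Sum>k<K. L k) \<le> 0 + (K * log 2 r + log 2 p)"
    using lim2 by (intro tendsto_le[OF sequentially_bot]) auto
  moreover have "(\<Sum>k<K. R k) \<le> (\<Sum>k<K. L k)" using L by (intro sum_mono) auto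
  ultimately show ?thesis by linarith
qed

lemma achievable_NS_log_p: "achievable_NS K (p ^ K) ny W (\<lambda>k. if k < K then log 2 p else 0)"
proof -
  obtain Z where Z: "\<And>n. ns_scheme K (p ^ K) ny n (\<lambda>_. p ^ n) (Z n)"
    "\<And>n k. k < K \<Longrightarrow> ns_err K (p ^ K) ny W n (\<lambda>_. p ^ n) (Z n) k = 0"
    using ns_zero_error by metis
  have "(\<lambda>k. ns_err K (p ^ K) ny W n (\<lambda>_. p ^ n) (Z n) k) ` {..<K} = (\<lambda>_. 0) ` {..<K}" for n
    using Z(2) by (intro image_cong) auto
  moreover have "0 \<in> {..<K}" using K by auto
  ultimately have "(\<lambda>k. ns_err K (p ^ K) ny W n (\<lambda>_. p ^ n) (Z n) k) ` {..<K} = {0}" for n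
    by (simp add: image_constant)
  then have "(\<lambda>n. Max ((\<lambda>k. ns_err K (p ^ K) ny W n (\<lambda>_. p ^ n) (Z n) k) ` {..<K})) \<longlonglongrightarrow> 0"
    by simp
  moreover have "(\<lambda>n. log 2 (real (p ^ n)) / real n) \<longlonglongrightarrow> log 2 p"
  proof (rule tendsto_eventually)
    show "\<forall>\<^sub>F n in sequentially. log 2 (real (p ^ n)) / real n = log 2 p"
      using eventually_gt_at_top[of 0] by eventually_elim (use p0 in \<open>simp add: log_nat_power\<close>)
  qed
  ultimately show ?thesis unfolding achievable_NS_def using Z(1)
    by (intro conjI exI[of _ "\<lambda>n _. p ^ n"] exI[of _ Z]) auto
qed

end

section \<open>Single-user codes from non-signalling schemes\<close>

lemma sum_msgs_coord:
  fixes g :: "nat \<Rightarrow> real"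
  assumes k: "k < K" and m: "m k \<ge> 1"
  shows "(\<Sum>w\<in>msgs K m. g (w k)) = real (\<Prod>i<K. m i) / real (m k) * (\<Sum>j<m k. g j)"
proof -
  have "(\<Sum>w\<in>msgs K m. g (w k)) = (\<Sum>w\<in>msgs K m. \<Prod>i<K. if i = k then g (w i) else 1)"
    using k by simp
  also have "\<dots> = (\<Prod>i<K. \<Sum>j<m i. if i = k then g j else 1)"
    unfolding msgs_def by (rule prod_sum_PiE[symmetric]) auto
  also have "\<dots> = (\<Sum>j<m k. g j) * (\<Prod>i\<in>{..<K} - {k}. real (m i))"
    using k by (subst prod.remove[of _ k]) auto
  also have "(\<Prod>i\<in>{..<K} - {k}. real (m i)) = real (\<Prod>i<K. m i) / real (m k)"
    using k m by (subst prod.remove[of "{..<K}" k]) auto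
  finally show ?thesis by simp
qed

section \<open>The link from the transmitter to one receiver of a general channel\<close>

locale dm_bc =
  fixes K nx :: nat and ny :: "nat \<Rightarrow> nat" and W :: "nat \<Rightarrow> (nat \<Rightarrow> nat) \<Rightarrow> real"
  assumes dm_bc: "is_dm_bc K nx ny W"
begin

lemma nx: "nx \<ge> 1" and ny: "k < K \<Longrightarrow> ny k \<ge> 1"
  using dm_bc unfolding is_dm_bc_def by auto

lemma W_nonneg: "x < nx \<Longrightarrow> y \<in> outs K ny \<Longrightarrow> W x y \<ge> 0"
  and W_sum: "x < nx \<Longrightarrow> (\<Sum>y\<in>outs K ny. W x y) = 1"
  using dm_bc unfolding is_dm_bc_def by auto

lemma chan_n_nonneg: "x \<in> xblocks nx n \<Longrightarrow> yy \<in> yblocks K ny n \<Longrightarrow> chan_n W K n x yy \<ge> 0"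
  unfolding chan_n_def
  by (intro prod_nonneg ballI W_nonneg) (auto simp: xblocks_def yblocks_def yblock_def outs_def PiE_iff)

text \<open>Transposing receiver-first blocks into time-first ones makes the sum factor over channel
  uses.\<close>

lemma chan_n_sum:
  assumes x: "x \<in> xblocks nx n"
  shows "(\<Sum>yy\<in>yblocks K ny n. chan_n W K n x yy) = 1"
proof -
  have "(\<Sum>yy\<in>yblocks K ny n. chan_n W K n x yy) = (\<Sum>z\<in>(\<Pi>\<^sub>E t\<in>{..<n}. outs K ny). \<Prod>t<n. W (x t) (z t))"
  proof (rule sum.reindex_bij_witness[where i = "\<lambda>z. \<lambda>k\<in>{..<K}. \<lambda>t\<in>{..<n}. z t k"
        and j = "\<lambda>yy. \<lambda>t\<in>{..<n}. \<lambda>k\<in>{..<K}. yy k t"])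
    fix yy assume yy: "yy \<in> yblocks K ny n"
    show "(\<lambda>k\<in>{..<K}. \<lambda>t\<in>{..<n}. (\<lambda>t\<in>{..<n}. \<lambda>k\<in>{..<K}. yy k t) t k) = yy"
      using yy unfolding yblocks_def yblock_def by (fastforce simp: fun_eq_iff PiE_iff extensional_def)
    show "(\<lambda>t\<in>{..<n}. \<lambda>k\<in>{..<K}. yy k t) \<in> (\<Pi>\<^sub>E t\<in>{..<n}. outs K ny)"
      using yy unfolding yblocks_def yblock_def outs_def by (auto simp: PiE_iff)
    show "(\<Prod>t<n. W (x t) ((\<lambda>t\<in>{..<n}. \<lambda>k\<in>{..<K}. yy k t) t)) = chan_n W K n x yy"
      unfolding chan_n_def by simp
  next
    fix z assume z: "z \<in> (\<Pi>\<^sub>E t\<in>{..<n}. outs K ny)"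
    show "(\<lambda>t\<in>{..<n}. \<lambda>k\<in>{..<K}. (\<lambda>k\<in>{..<K}. \<lambda>t\<in>{..<n}. z t k) k t) = z"
      using z unfolding outs_def by (fastforce simp: fun_eq_iff PiE_iff extensional_def)
    show "(\<lambda>k\<in>{..<K}. \<lambda>t\<in>{..<n}. z t k) \<in> yblocks K ny n"
      using z unfolding yblocks_def yblock_def outs_def by (auto simp: PiE_iff)
  qed
  also have "\<dots> = (\<Prod>t<n. \<Sum>y\<in>outs K ny. W (x t) y)"
    by (rule prod_sum_PiE[symmetric]) (auto simp: outs_def intro: finite_PiE)
  also have "\<dots> = 1" using x W_sum by (auto simp: xblocks_def PiE_iff)
  finally show ?thesis .
qed

text \<open>The point-to-point channel over \<open>n\<close> uses seen by receiver \<open>k\<close>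
  alone.\<close>

definition V :: "nat \<Rightarrow> nat \<Rightarrow> (nat \<Rightarrow> nat) \<Rightarrow> (nat \<Rightarrow> nat) \<Rightarrow> real" where
  "V n k x y = (\<Sum>yy\<in>{yy\<in>yblocks K ny n. yy k = y}. chan_n W K n x yy)"

lemma V_nonneg: "x \<in> xblocks nx n \<Longrightarrow> V n k x y \<ge> 0"
  unfolding V_def by (intro sum_nonneg) (auto intro: chan_n_nonneg)

lemma sum_V:
  assumes k: "k < K"
  shows "(\<Sum>yy\<in>yblocks K ny n. chan_n W K n x yy * g (yy k)) = (\<Sum>y\<in>yblock (ny k) n. V n k x y * g y)"
proof -
  have "(\<Sum>yy\<in>yblocks K ny n. chan_n W K n x yy * g (yy k))
      = (\<Sum>y\<in>yblock (ny k) n. \<Sum>yy\<in>{yy\<in>yblocks K ny n. yy k = y}. chan_n W K n x yy * g (yy k))"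
    using k by (intro sum.group[symmetric] finite_yblocks finite_yblock) (auto simp: yblocks_def)
  also have "\<dots> = (\<Sum>y\<in>yblock (ny k) n. V n k x y * g y)"
    unfolding V_def sum_distrib_right by (intro sum.cong refl) auto
  finally show ?thesis .
qed

lemma V_sum_1: "k < K \<Longrightarrow> x \<in> xblocks nx n \<Longrightarrow> (\<Sum>y\<in>yblock (ny k) n. V n k x y) = 1"
  using sum_V[of k n x "\<lambda>_. 1"] chan_n_sum by simp

lemma V_le_1:
  assumes "k < K" "x \<in> xblocks nx n" "y \<in> yblock (ny k) n"
  shows "V n k x y \<le> 1"
proof -
  have "V n k x y \<le> (\<Sum>y\<in>yblock (ny k) n. V n k x y)"
    using assms V_nonneg finite_yblock by (intro member_le_sum) auto
  then show ?thesis using V_sum_1 assms by simp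
qed

lemma classical_err_nonneg:
  assumes sch: "classical_scheme K nx ny n m enc dec" and k: "k < K"
  shows "0 \<le> classical_err K nx ny W n m enc dec k"
  unfolding classical_err_def
proof (intro mult_nonneg_nonneg sum_nonneg)
  fix w x yy j assume *: "w \<in> msgs K m" "x \<in> xblocks nx n" "yy \<in> yblocks K ny n"
  show "0 \<le> enc w x" "0 \<le> chan_n W K n x yy"
    using sch * chan_n_nonneg unfolding classical_scheme_def by auto
  have "yy k \<in> yblock (ny k) n" using * k unfolding yblocks_def by auto
  then show "0 \<le> dec k (yy k) j" if "j \<in> {..<m k} - {w k}"
    using sch k that unfolding classical_scheme_def by auto
qed (simp add: prod_nonneg)

lemma classical_err_eq:
  assumes sch: "classical_scheme K nx ny n m enc dec" and k: "k < K"
  shows "classical_err K nx ny W n m enc dec k = 1 - (1 / real (\<Prod>i<K. m i)) *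
     (\<Sum>w\<in>msgs K m. \<Sum>x\<in>xblocks nx n. enc w x * (\<Sum>y\<in>yblock (ny k) n. V n k x y * dec k y (w k)))"
proof -
  have m: "m i \<ge> 1" if "i < K" for i using sch that unfolding classical_scheme_def by blast
  have Q: "real (\<Prod>i<K. m i) \<noteq> 0" using m by fastforce
  have enc: "(\<Sum>x\<in>xblocks nx n. enc w x) = 1" if "w \<in> msgs K m" for w
    using sch that unfolding classical_scheme_def by blast
  have "(\<Sum>yy\<in>yblocks K ny n. enc w x * chan_n W K n x yy * (\<Sum>j\<in>{..<m k} - {w k}. dec k (yy k) j))
      = enc w x - enc w x * (\<Sum>y\<in>yblock (ny k) n. V n k x y * dec k y (w k))"
    if w: "w \<in> msgs K m" and x: "x \<in> xblocks nx n" for w x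
  proof -
    have "(\<Sum>yy\<in>yblocks K ny n. enc w x * chan_n W K n x yy * (\<Sum>j\<in>{..<m k} - {w k}. dec k (yy k) j))
        = enc w x * (\<Sum>y\<in>yblock (ny k) n. V n k x y * (\<Sum>j\<in>{..<m k} - {w k}. dec k y j))"
      unfolding sum_V[OF k, symmetric] by (simp add: sum_distrib_left mult.assoc)
    also have "(\<Sum>y\<in>yblock (ny k) n. V n k x y * (\<Sum>j\<in>{..<m k} - {w k}. dec k y j))
        = (\<Sum>y\<in>yblock (ny k) n. V n k x y - V n k x y * dec k y (w k))"
    proof (rule sum.cong[OF refl])
      fix y assume "y \<in> yblock (ny k) n"
      then have "(\<Sum>j<m k. dec k y j) = 1" using sch k unfolding classical_scheme_def by blast
      moreover have "w k \<in> {..<m k}" using w k unfolding msgs_def by auto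
      ultimately have "(\<Sum>j\<in>{..<m k} - {w k}. dec k y j) = 1 - dec k y (w k)"
        by (simp add: sum_diff1)
      then show "V n k x y * (\<Sum>j\<in>{..<m k} - {w k}. dec k y j) = V n k x y - V n k x y * dec k y (w k)"
        by (simp only: right_diff_distrib mult_1_right)
    qed
    finally show ?thesis using V_sum_1[OF k x] by (simp add: sum_subtractf algebra_simps)
  qed
  then have "classical_err K nx ny W n m enc dec k = (1 / real (\<Prod>i<K. m i)) *
     (\<Sum>w\<in>msgs K m. 1 - (\<Sum>x\<in>xblocks nx n. enc w x * (\<Sum>y\<in>yblock (ny k) n. V n k x y * dec k y (w k))))"
    unfolding classical_err_def by (simp add: sum_subtractf enc cong: sum.cong)
  also have "\<dots> = 1 - (1 / real (\<Prod>i<K. m i)) *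
     (\<Sum>w\<in>msgs K m. \<Sum>x\<in>xblocks nx n. enc w x * (\<Sum>y\<in>yblock (ny k) n. V n k x y * dec k y (w k)))"
    using Q by (simp add: sum_subtractf card_msgs algebra_simps)
  finally show ?thesis .
qed

text \<open>With every transition probability bounded by 1, the success summed over the messages of
  user \<open>k\<close> is at most the total decoding mass, one unit per output block.\<close>

lemma classical_msgs_le:
  assumes sch: "classical_scheme K nx ny n m enc dec" and k: "k < K"
  shows "real (m k) * (1 - classical_err K nx ny W n m enc dec k) \<le> real (ny k) ^ n"
proof -
  define Q where "Q = real (\<Prod>i<K. m i)"
  have m: "m i \<ge> 1" if "i < K" for i using sch that unfolding classical_scheme_def by blast
  have Q: "Q > 0" unfolding Q_def using m by (auto intro!: prod_pos simp: Suc_le_eq)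
  have dec: "(\<forall>j<m k. dec k y j \<ge> 0) \<and> (\<Sum>j<m k. dec k y j) = 1" if "y \<in> yblock (ny k) n" for y
    using sch k that unfolding classical_scheme_def by blast
  have enc: "(\<forall>x\<in>xblocks nx n. enc w x \<ge> 0) \<and> (\<Sum>x\<in>xblocks nx n. enc w x) = 1" if "w \<in> msgs K m" for w
    using sch that unfolding classical_scheme_def by blast
  have "(\<Sum>w\<in>msgs K m. \<Sum>x\<in>xblocks nx n. enc w x * (\<Sum>y\<in>yblock (ny k) n. V n k x y * dec k y (w k)))
      \<le> (\<Sum>w\<in>msgs K m. \<Sum>x\<in>xblocks nx n. enc w x * (\<Sum>y\<in>yblock (ny k) n. dec k y (w k)))"
  proof (intro sum_mono mult_left_mono)
    fix w x y assume *: "w \<in> msgs K m" "x \<in> xblocks nx n" "y \<in> yblock (ny k) n"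
    have "dec k y (w k) \<ge> 0" using dec[OF *(3)] *(1) k unfolding msgs_def by auto
    then show "V n k x y * dec k y (w k) \<le> dec k y (w k)"
      using V_le_1[OF k *(2,3)] by (simp add: mult_left_le_one_le V_nonneg[OF *(2)])
  qed (use enc in auto)
  also have "\<dots> = (\<Sum>w\<in>msgs K m. \<Sum>y\<in>yblock (ny k) n. dec k y (w k))"
    using enc by (intro sum.cong[OF refl]) (subst sum_distrib_right[symmetric], simp)
  also have "\<dots> = (\<Sum>y\<in>yblock (ny k) n. Q / real (m k))"
    using dec sum_msgs_coord[of k K m, OF k m[OF k]] by (subst sum.swap) (simp add: Q_def)
  also have "\<dots> = real (ny k) ^ n * (Q / real (m k))"
    by (simp add: yblock_def card_PiE)
  finally have "(1 / Q) * (\<Sum>w\<in>msgs K m. \<Sum>x\<in>xblocks nx n. enc w x * (\<Sum>y\<in>yblock (ny k) n. V n k x y * dec k y (w k)))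
      \<le> (1 / Q) * (real (ny k) ^ n * (Q / real (m k)))"
    using Q by (intro mult_left_mono) auto
  also have "\<dots> = real (ny k) ^ n / real (m k)" using Q by simp
  finally have "1 - classical_err K nx ny W n m enc dec k \<le> real (ny k) ^ n / real (m k)"
    unfolding classical_err_eq[OF sch k] Q_def[symmetric] by simp
  then show ?thesis using m[OF k] by (simp add: field_simps)
qed

text \<open>A crude bound that makes the sum of rates bounded on the capacity region, so that its
  supremum is meaningful. Once the error is below 1/2 there are at most \<open>2 * ny k ^ n\<close>
  messages.\<close>

lemma achievable_C_le:
  assumes R: "achievable_C K nx ny W R" and k: "k < K"
  shows "R k \<le> log 2 (real (ny k))"
proof -
  from R obtain m enc dec where
    sch: "\<And>n. classical_scheme K nx ny n (m n) (enc n) (dec n)"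
    and lim: "(\<lambda>n. Max ((\<lambda>k. classical_err K nx ny W n (m n) (enc n) (dec n) k) ` {..<K})) \<longlonglongrightarrow> 0"
    and rate: "\<forall>k<K. \<exists>L. (\<lambda>n. log 2 (real (m n k)) / real n) \<longlonglongrightarrow> L \<and> L \<ge> R k"
    unfolding achievable_C_def by blast
  from rate k obtain L where L: "(\<lambda>n. log 2 (real (m n k)) / real n) \<longlonglongrightarrow> L" "L \<ge> R k" by blast
  have "(\<lambda>n. 1 / real n + log 2 (real (ny k))) \<longlonglongrightarrow> 0 + log 2 (real (ny k))"
    by (intro tendsto_intros lim_const_over_n)
  moreover have "\<forall>\<^sub>F n in sequentially. log 2 (real (m n k)) / real n \<le> 1 / real n + log 2 (real (ny k))"
  proof -
    have "\<forall>\<^sub>F n in sequentially. Max ((\<lambda>k. classical_err K nx ny W n (m n) (enc n) (dec n) k) ` {..<K}) < 1 / 2"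
      using lim by (intro order_tendstoD(2)) auto
    then show ?thesis using eventually_gt_at_top[of 0]
    proof eventually_elim
      case (elim n)
      have m: "m n k \<ge> 1" using sch[of n] k unfolding classical_scheme_def by auto
      have "classical_err K nx ny W n (m n) (enc n) (dec n) k
          \<le> Max ((\<lambda>k. classical_err K nx ny W n (m n) (enc n) (dec n) k) ` {..<K})"
        using k by (intro Max_ge) auto
      then have "real (m n k) * (1 / 2) \<le> real (m n k) * (1 - classical_err K nx ny W n (m n) (enc n) (dec n) k)"
        using elim by (intro mult_left_mono) auto
      also have "\<dots> \<le> real (ny k) ^ n" by (rule classical_msgs_le[OF sch k])
      finally have "log 2 (real (m n k)) \<le> log 2 (2 * real (ny k) ^ n)"
        using m ny[OF k] by (subst log_le_cancel_iff) auto
      also have "\<dots> = 1 + n * log 2 (real (ny k))"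
        using ny[OF k] by (simp add: log_mult log_nat_power)
      finally show ?case using elim by (simp add: field_simps)
    qed
  qed
  ultimately have "L \<le> 0 + log 2 (real (ny k))"
    using L(1) by (intro tendsto_le[OF sequentially_bot]) auto
  then show ?thesis using L(2) by linarith
qed

lemma ns_marg_tx:
  assumes x: "x \<in> xblocks nx n"
  shows "ns_marg K nx n m Z True S w yy x w' = (\<Sum>wh\<in>msgs K m. if \<forall>k\<in>S. wh k = w' k then Z w yy x wh else 0)"
proof -
  have "ns_marg K nx n m Z True S w yy x w'
      = (\<Sum>x'\<in>xblocks nx n. if x' = x then (\<Sum>wh\<in>msgs K m. if \<forall>k\<in>S. wh k = w' k then Z w yy x' wh else 0) else 0)"
    unfolding ns_marg_def by (intro sum.cong refl) auto
  then show ?thesis using x by (simp add: card_xblocks)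
qed

lemma ns_marg_rx: "ns_marg K nx n m Z False S w yy x0 w'
   = (\<Sum>x\<in>xblocks nx n. \<Sum>wh\<in>msgs K m. if \<forall>k\<in>S. wh k = w' k then Z w yy x wh else 0)"
  unfolding ns_marg_def by simp

lemma ns_err_nonneg:
  assumes "ns_scheme K nx ny n m Z"
  shows "0 \<le> ns_err K nx ny W n m Z k"
  unfolding ns_err_def
proof (intro mult_nonneg_nonneg sum_nonneg)
  fix w yy x wh assume "w \<in> msgs K m" "yy \<in> yblocks K ny n" "x \<in> xblocks nx n" "wh \<in> msgs K m"
  then show "0 \<le> (if wh k \<noteq> w k then Z w yy x wh * chan_n W K n x yy else 0)"
    using assms chan_n_nonneg unfolding ns_scheme_def by auto
qed (simp add: prod_nonneg)

text \<open>The only properties of a non-signalling box seen by receiver \<open>k\<close>: \<open>\<pi>\<close> is the law of the channel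
  input, and \<open>\<rho> x y\<close> the average probability that the box outputs \<open>x\<close> and decodes correctly on input \<open>y\<close>.\<close>
lemma ns_scheme_reduce:
  assumes ns: "ns_scheme K nx ny n m Z" and k: "k < K"
  shows "\<exists>\<pi> \<rho>. (\<forall>x\<in>xblocks nx n. \<pi> x \<ge> 0) \<and> (\<Sum>x\<in>xblocks nx n. \<pi> x) = (1::real) \<and>
    (\<forall>x\<in>xblocks nx n. \<forall>y\<in>yblock (ny k) n. \<rho> x y \<in> {0..\<pi> x}) \<and>
    (\<forall>y\<in>yblock (ny k) n. (\<Sum>x\<in>xblocks nx n. \<rho> x y) = 1 / real (m k)) \<and>
    (\<Sum>x\<in>xblocks nx n. \<Sum>y\<in>yblock (ny k) n. V n k x y * \<rho> x y) = 1 - ns_err K nx ny W n m Z k"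
proof -
  let ?X = "xblocks nx n" and ?Y = "yblock (ny k) n" and ?M = "msgs K m"
  define Q where "Q = real (\<Prod>i<K. m i)"
  have m: "m i \<ge> 1" if "i < K" for i using ns that unfolding ns_scheme_def by blast
  have Q: "Q > 0" unfolding Q_def using m by (auto intro!: prod_pos simp: Suc_le_eq)
  have Z0: "Z w yy x wh \<ge> 0" if "w \<in> ?M" "yy \<in> yblocks K ny n" "x \<in> ?X" "wh \<in> ?M" for w yy x wh
    using ns that unfolding ns_scheme_def by blast
  have Z1: "(\<Sum>x\<in>?X. \<Sum>wh\<in>?M. Z w yy x wh) = 1" if "w \<in> ?M" "yy \<in> yblocks K ny n" for w yy
    using ns that unfolding ns_scheme_def by blast
  have sig: "ns_marg K nx n m Z t S w yy x0 wh0 = ns_marg K nx n m Z t S w' yy' x0 wh0"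
    if "S \<subseteq> {..<K}" "w \<in> ?M" "w' \<in> ?M" "yy \<in> yblocks K ny n" "yy' \<in> yblocks K ny n"
      "t \<longrightarrow> w = w'" "\<forall>k\<in>S. yy k = yy' k" "x0 \<in> ?X" "wh0 \<in> ?M" for t S w w' yy yy' x0 wh0
    using ns that unfolding ns_scheme_def by blast
  \<comment> \<open>Completes the input of receiver \<open>k\<close> by zero blocks for the others;
    by non-signalling the filler does not affect the marginals used here.\<close>
  define e where "e y = (\<lambda>i\<in>{..<K}. if i = k then y else (\<lambda>t\<in>{..<n}. 0))" for y :: "nat \<Rightarrow> nat"
  have e: "e y \<in> yblocks K ny n" "e y k = y" if "y \<in> ?Y" for y
    using that k ny unfolding e_def yblocks_def yblock_def by (auto simp: PiE_iff Suc_le_eq)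
  define y0 where "y0 = (\<lambda>t\<in>{..<n}. 0::nat)"
  have y0: "y0 \<in> ?Y" unfolding y0_def yblock_def using ny[OF k] by auto
  define x0 where "x0 = (\<lambda>t\<in>{..<n}. 0::nat)"
  have x0: "x0 \<in> ?X" unfolding x0_def xblocks_def using nx by auto
  define w0 where "w0 = (\<lambda>i\<in>{..<K}. 0::nat)"
  have w0: "w0 \<in> ?M" unfolding w0_def msgs_def using m by (auto simp: Suc_le_eq)
  define pw where "pw w x = ns_marg K nx n m Z True {} w (e y0) x w" for w x
  define q where "q w y x = ns_marg K nx n m Z True {k} w (e y) x w" for w y x
  have pw: "pw w x = (\<Sum>wh\<in>?M. Z w yy x wh)" if "w \<in> ?M" "yy \<in> yblocks K ny n" "x \<in> ?X" for w yy x
    unfolding pw_def using sig[of "{}" w w "e y0" yy True x w] that e y0 by (simp add: ns_marg_tx)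
  have q: "q w (yy k) x = (\<Sum>wh\<in>?M. if wh k = w k then Z w yy x wh else 0)"
    if w: "w \<in> ?M" "yy \<in> yblocks K ny n" "x \<in> ?X" for w yy x
  proof -
    have "yy k \<in> ?Y" using that(2) k unfolding yblocks_def by auto
    then show ?thesis
      unfolding q_def using sig[of "{k}" w w "e (yy k)" yy True x w] that e k by (simp add: ns_marg_tx)
  qed
  define \<pi> where "\<pi> x = (\<Sum>w\<in>?M. pw w x) / Q" for x
  define \<rho> where "\<rho> x y = (\<Sum>w\<in>?M. q w y x) / Q" for x y
  have pw_sum: "(\<Sum>x\<in>?X. pw w x) = 1" if "w \<in> ?M" for w
    using pw[OF that e(1)[OF y0]] Z1[OF that e(1)[OF y0]] by simp
  show ?thesis
  proof (intro exI[of _ \<pi>] exI[of _ \<rho>] conjI ballI)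
    show "\<pi> x \<ge> 0" if "x \<in> ?X" for x
      unfolding \<pi>_def using pw[OF _ e(1)[OF y0] that] Z0[OF _ e(1)[OF y0] that] Q
      by (auto intro!: divide_nonneg_pos sum_nonneg)
    show "(\<Sum>x\<in>?X. \<pi> x) = 1"
    proof -
      have "(\<Sum>x\<in>?X. \<Sum>w\<in>?M. pw w x) = Q"
        by (subst sum.swap) (simp add: pw_sum card_msgs Q_def)
      then show ?thesis unfolding \<pi>_def sum_divide_distrib[symmetric] using Q by simp
    qed
    show "\<rho> x y \<in> {0..\<pi> x}" if x: "x \<in> ?X" and y: "y \<in> ?Y" for x y
    proof -
      have "0 \<le> q w y x \<and> q w y x \<le> pw w x" if w: "w \<in> ?M" for w
        using q[OF w e(1)[OF y] x] pw[OF w e(1)[OF y] x] Z0[OF w e(1)[OF y] x] e(2)[OF y]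
        by (auto intro!: sum_nonneg sum_mono)
      then show ?thesis unfolding \<rho>_def \<pi>_def using Q
        by (auto intro!: divide_nonneg_pos sum_nonneg divide_right_mono sum_mono)
    qed
    show "(\<Sum>x\<in>?X. \<rho> x y) = 1 / real (m k)" if y: "y \<in> ?Y" for y
    proof -
      \<comment> \<open>Without the transmitter, the output law of receiver \<open>k\<close> cannot
        depend on \<open>w\<close>, so \<open>w\<close> may be replaced by the fixed
        \<open>w0\<close>. The uniform message is then independent of the guess and is hit with
        probability \<open>1 / m k\<close>.\<close>
      have "(\<Sum>x\<in>?X. \<Sum>w\<in>?M. q w y x) = (\<Sum>w\<in>?M. \<Sum>x\<in>?X. q w y x)" by (rule sum.swap)
      also have "\<dots> = (\<Sum>w\<in>?M. \<Sum>x\<in>?X. \<Sum>wh\<in>?M. if wh k = w k then Z w0 (e y) x wh else 0)"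
      proof (rule sum.cong[OF refl])
        fix w assume w: "w \<in> ?M"
        have "(\<Sum>x\<in>?X. q w y x) = ns_marg K nx n m Z False {k} w (e y) x0 w"
          unfolding ns_marg_rx using q[OF w e(1)[OF y]] e(2)[OF y] by simp
        also have "\<dots> = ns_marg K nx n m Z False {k} w0 (e y) x0 w"
          using w w0 e(1)[OF y] x0 k by (intro sig) auto
        finally show "(\<Sum>x\<in>?X. q w y x) = (\<Sum>x\<in>?X. \<Sum>wh\<in>?M. if wh k = w k then Z w0 (e y) x wh else 0)"
          unfolding ns_marg_rx by simp
      qed
      also have "\<dots> = (\<Sum>x\<in>?X. \<Sum>wh\<in>?M. \<Sum>w\<in>?M. if wh k = w k then Z w0 (e y) x wh else 0)"
        by (subst sum.swap, rule sum.cong[OF refl], rule sum.swap)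
      also have "\<dots> = (\<Sum>x\<in>?X. \<Sum>wh\<in>?M. Q / real (m k) * Z w0 (e y) x wh)"
      proof (intro sum.cong refl)
        fix x wh assume "wh \<in> ?M"
        then have "wh k < m k" using k unfolding msgs_def by auto
        then have "(\<Sum>j<m k. if wh k = j then Z w0 (e y) x wh else 0) = Z w0 (e y) x wh" by simp
        then show "(\<Sum>w\<in>?M. if wh k = w k then Z w0 (e y) x wh else 0) = Q / real (m k) * Z w0 (e y) x wh"
          using sum_msgs_coord[of k K m "\<lambda>j. if wh k = j then Z w0 (e y) x wh else 0", OF k m[OF k]]
          unfolding Q_def by simp
      qed
      also have "\<dots> = Q / real (m k)"
        using Z1[OF w0 e(1)[OF y]] unfolding sum_distrib_left[symmetric] by simp
      finally show ?thesis unfolding \<rho>_def sum_divide_distrib[symmetric] using Q by simp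
    qed
    show "(\<Sum>x\<in>?X. \<Sum>y\<in>?Y. V n k x y * \<rho> x y) = 1 - ns_err K nx ny W n m Z k"
    proof -
      have "(\<Sum>yy\<in>yblocks K ny n. \<Sum>x\<in>?X. \<Sum>wh\<in>?M. if wh k \<noteq> w k then Z w yy x wh * chan_n W K n x yy else 0)
          = 1 - (\<Sum>x\<in>?X. \<Sum>y\<in>?Y. V n k x y * q w y x)" if w: "w \<in> ?M" for w
      proof -
        \<comment> \<open>Wrong decisions are what \<open>q\<close> leaves of \<open>pw\<close>.
          Since \<open>pw\<close> ignores the outputs and \<open>q\<close> sees only
          \<open>yy k\<close>, the channel can be reduced to \<open>V n k\<close>.\<close>
        have "(\<Sum>wh\<in>?M. if wh k \<noteq> w k then Z w yy x wh * chan_n W K n x yy else 0)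
            = chan_n W K n x yy * pw w x - chan_n W K n x yy * q w (yy k) x"
          if "yy \<in> yblocks K ny n" "x \<in> ?X" for yy x
          unfolding pw[OF w that] q[OF w that] sum_distrib_left sum_subtractf[symmetric]
          by (rule sum.cong[OF refl]) (simp add: mult.commute)
        then have "(\<Sum>yy\<in>yblocks K ny n. \<Sum>x\<in>?X. \<Sum>wh\<in>?M. if wh k \<noteq> w k then Z w yy x wh * chan_n W K n x yy else 0)
            = (\<Sum>x\<in>?X. \<Sum>yy\<in>yblocks K ny n. chan_n W K n x yy * pw w x - chan_n W K n x yy * q w (yy k) x)"
          by (subst sum.swap) simp
        also have "\<dots> = (\<Sum>x\<in>?X. pw w x - (\<Sum>y\<in>?Y. V n k x y * q w y x))"
        proof (rule sum.cong[OF refl])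
          fix x assume "x \<in> ?X"
          then show "(\<Sum>yy\<in>yblocks K ny n. chan_n W K n x yy * pw w x - chan_n W K n x yy * q w (yy k) x)
              = pw w x - (\<Sum>y\<in>?Y. V n k x y * q w y x)"
            using sum_V[OF k, of n x "\<lambda>y. q w y x"]
            by (simp add: sum_subtractf chan_n_sum flip: sum_distrib_right)
        qed
        also have "\<dots> = 1 - (\<Sum>x\<in>?X. \<Sum>y\<in>?Y. V n k x y * q w y x)"
          using pw_sum[OF w] by (simp add: sum_subtractf)
        finally show ?thesis .
      qed
      then have "ns_err K nx ny W n m Z k = (1 / Q) * (\<Sum>w\<in>?M. 1 - (\<Sum>x\<in>?X. \<Sum>y\<in>?Y. V n k x y * q w y x))"
        unfolding ns_err_def Q_def by simp
      also have "\<dots> = 1 - (\<Sum>w\<in>?M. \<Sum>x\<in>?X. \<Sum>y\<in>?Y. V n k x y * q w y x) / Q"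
      proof -
        have "real (card ?M) = Q" by (simp add: card_msgs Q_def)
        then show ?thesis using Q by (simp add: sum_subtractf diff_divide_distrib)
      qed
      also have "(\<Sum>w\<in>?M. \<Sum>x\<in>?X. \<Sum>y\<in>?Y. V n k x y * q w y x) = (\<Sum>x\<in>?X. \<Sum>w\<in>?M. \<Sum>y\<in>?Y. V n k x y * q w y x)"
        by (rule sum.swap)
      also have "\<dots> = (\<Sum>x\<in>?X. \<Sum>y\<in>?Y. \<Sum>w\<in>?M. V n k x y * q w y x)"
        by (rule sum.cong[OF refl], rule sum.swap)
      also have "\<dots> / Q = (\<Sum>x\<in>?X. \<Sum>y\<in>?Y. V n k x y * \<rho> x y)"
        unfolding \<rho>_def by (simp add: sum_divide_distrib sum_distrib_left)
      finally show ?thesis by simp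
    qed
  qed
qed

text \<open>\<open>random_coding\<close> is applied to the link \<open>V n k\<close>; the other
  users get singleton message sets and never err. The success is at least
  \<open>(1 - \<epsilon>) * (1 - B)\<close>, whose complement is at most
  \<open>\<epsilon> + B\<close>.\<close>

lemma ns_to_classical:
  assumes ns: "ns_scheme K nx ny n m Z" and k: "k < K" and l: "l \<ge> 1"
  shows "\<exists>enc dec. classical_scheme K nx ny n (\<lambda>i. if i = k then l else 1) enc dec \<and>
    (\<forall>i<K. classical_err K nx ny W n (\<lambda>i. if i = k then l else 1) enc dec i
       \<le> ns_err K nx ny W n m Z k + (real l - 1) / real (m k))"
proof -
  let ?X = "xblocks nx n" and ?Y = "yblock (ny k) n"
  define m' where "m' = (\<lambda>i. if i = k then l else 1)"
  define \<epsilon> where "\<epsilon> = ns_err K nx ny W n m Z k"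
  define B where "B = (real l - 1) / real (m k)"
  have B0: "B \<ge> 0" unfolding B_def using l by simp
  have e0: "\<epsilon> \<ge> 0" unfolding \<epsilon>_def by (rule ns_err_nonneg[OF ns])
  obtain \<pi> \<rho> where r: "\<forall>x\<in>?X. \<pi> x \<ge> 0" "(\<Sum>x\<in>?X. \<pi> x) = 1" "\<forall>x\<in>?X. \<forall>y\<in>?Y. \<rho> x y \<in> {0..\<pi> x}"
    "\<forall>y\<in>?Y. (\<Sum>x\<in>?X. \<rho> x y) = 1 / real (m k)" "(\<Sum>x\<in>?X. \<Sum>y\<in>?Y. V n k x y * \<rho> x y) = 1 - \<epsilon>"
    using ns_scheme_reduce[OF ns k] unfolding \<epsilon>_def by blast
  have "\<exists>c\<in>{..<l} \<rightarrow>\<^sub>E ?X. \<exists>d. (\<forall>y\<in>?Y. (\<forall>i<l. d y i \<ge> 0) \<and> (\<Sum>i<l. d y i) = 1) \<and>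
     real l * ((\<Sum>x\<in>?X. \<Sum>y\<in>?Y. V n k x y * \<rho> x y) * (1 - (real l - 1) / real (m k)))
       \<le> (\<Sum>i<l. \<Sum>y\<in>?Y. V n k (c i) y * d y i)"
    by (rule random_coding[of ?X ?Y "V n k" \<pi>])
      (use r(1-4) l in \<open>auto simp: card_xblocks finite_yblock V_nonneg\<close>)
  then obtain c d where c: "c \<in> {..<l} \<rightarrow>\<^sub>E ?X"
    and d: "\<forall>y\<in>?Y. (\<forall>i<l. d y i \<ge> 0) \<and> (\<Sum>i<l. d y i) = 1"
    and succ: "real l * ((1 - \<epsilon>) * (1 - B)) \<le> (\<Sum>i<l. \<Sum>y\<in>?Y. V n k (c i) y * d y i)"
    unfolding r(5) B_def by blast
  define enc where "enc w x = (if x = c (w k) then 1 else 0 :: real)" for w x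
  define dec where "dec i y j = (if i = k then d y j else 1)" for i y j
  have cX: "c (w k) \<in> ?X" if "w \<in> msgs K m'" for w
  proof -
    have "w k < m' k" using that k unfolding msgs_def by auto
    then show ?thesis using c unfolding m'_def by auto
  qed
  have sch: "classical_scheme K nx ny n m' enc dec"
    unfolding classical_scheme_def
  proof (intro conjI allI impI ballI)
    show "(\<Sum>x\<in>?X. enc w x) = 1" if "w \<in> msgs K m'" for w
      unfolding enc_def using cX[OF that] card_xblocks(2) by simp
  qed (use l d in \<open>auto simp: enc_def dec_def m'_def\<close>)
  have pm: "(\<Prod>i<K. m' i) = l" unfolding m'_def using k by simp
  have err: "classical_err K nx ny W n m' enc dec i \<le> \<epsilon> + B" if i: "i < K" for i
  proof (cases "i = k")
    case True
    have "(\<Sum>w\<in>msgs K m'. \<Sum>x\<in>?X. enc w x * (\<Sum>y\<in>?Y. V n k x y * dec k y (w k)))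
        = (\<Sum>w\<in>msgs K m'. \<Sum>y\<in>?Y. V n k (c (w k)) y * d y (w k))"
    proof (rule sum.cong[OF refl])
      fix w assume w: "w \<in> msgs K m'"
      have "(\<Sum>x\<in>?X. enc w x * (\<Sum>y\<in>?Y. V n k x y * dec k y (w k)))
          = (\<Sum>x\<in>?X. if x = c (w k) then (\<Sum>y\<in>?Y. V n k x y * d y (w k)) else 0)"
        unfolding enc_def dec_def by (intro sum.cong refl) auto
      then show "(\<Sum>x\<in>?X. enc w x * (\<Sum>y\<in>?Y. V n k x y * dec k y (w k)))
          = (\<Sum>y\<in>?Y. V n k (c (w k)) y * d y (w k))"
        using cX[OF w] card_xblocks(2) by simp
    qed
    also have "\<dots> = real l / real l * (\<Sum>j<l. \<Sum>y\<in>?Y. V n k (c j) y * d y j)"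
      using sum_msgs_coord[of k K m' "\<lambda>j. \<Sum>y\<in>?Y. V n k (c j) y * d y j", OF k] l pm
      unfolding m'_def by simp
    finally have "classical_err K nx ny W n m' enc dec k
        = 1 - (1 / real l) * (\<Sum>j<l. \<Sum>y\<in>?Y. V n k (c j) y * d y j)"
      unfolding classical_err_eq[OF sch k] pm using l by simp
    also have "\<dots> \<le> 1 - (1 / real l) * (real l * ((1 - \<epsilon>) * (1 - B)))"
      using succ by (intro diff_left_mono mult_left_mono) auto
    also have "\<dots> = \<epsilon> + B - \<epsilon> * B" using l by (simp add: algebra_simps)
    also have "\<dots> \<le> \<epsilon> + B" using e0 B0 by simp
    finally show ?thesis using True by simp
  next
    case False
    have "(\<Sum>j\<in>{..<m' i} - {w i}. dec i y j) = 0" if "w \<in> msgs K m'" for w y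
    proof -
      have "w i < m' i" using that i unfolding msgs_def by auto
      then have "{..<m' i} - {w i} = {}" using False unfolding m'_def by auto
      then show ?thesis by (simp only: sum.empty)
    qed
    then have "classical_err K nx ny W n m' enc dec i = 0"
      unfolding classical_err_def mult_eq_0_iff by (intro disjI2 sum.neutral ballI) simp
    then show ?thesis using e0 B0 by simp
  qed
  show ?thesis using sch err unfolding m'_def \<epsilon>_def B_def by blast
qed

end

section \<open>Sum-capacities\<close>

context dm_bc
begin

text \<open>\<open>ns_to_classical\<close> is applied at every blocklength with about
  \<open>m / n\<close> messages: the added error is at most \<open>1 / n\<close>, and the rate drops
  by at most \<open>(1 + log 2 n) / n\<close>.\<close>

lemma single_user_achievable_C:
  assumes R: "achievable_NS K nx ny W R" and k: "k < K"
  shows "achievable_C K nx ny W (\<lambda>i. if i = k then R k else 0)"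
proof -
  from R obtain m Z where
    ns: "\<And>n. ns_scheme K nx ny n (m n) (Z n)"
    and lim: "(\<lambda>n. Max ((\<lambda>k. ns_err K nx ny W n (m n) (Z n) k) ` {..<K})) \<longlonglongrightarrow> 0"
    and rate: "\<forall>k<K. \<exists>L. (\<lambda>n. log 2 (real (m n k)) / real n) \<longlonglongrightarrow> L \<and> L \<ge> R k"
    unfolding achievable_NS_def by blast
  from rate k obtain L where L: "(\<lambda>n. log 2 (real (m n k)) / real n) \<longlonglongrightarrow> L" "L \<ge> R k" by blast
  have m: "m n k \<ge> 1" for n using ns[of n] k unfolding ns_scheme_def by blast
  text \<open>Using only a fraction \<open>1 / n\<close> of the messages costs no rate.\<close>
  define l where "l n = max 1 (m n k div n)" for n
  define m' where "m' n = (\<lambda>i. if i = k then l n else 1)" for n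
  have l1: "l n \<ge> 1" for n unfolding l_def by simp
  \<comment> \<open>If the quotient is at most 1 then \<open>l n = 1\<close> and the left side
    vanishes; this covers \<open>n = 0\<close>, where the division gives 0.\<close>
  have lm: "(real (l n) - 1) / real (m n k) \<le> 1 / real n" for n
  proof (cases "m n k div n \<le> 1")
    case False
    have "real (m n k div n) \<le> real (m n k) / real n" by (rule of_nat_div_le_of_nat)
    then have "real (l n) \<le> real (m n k) / real n" using False unfolding l_def by simp
    then have "(real (l n) - 1) / real (m n k) \<le> (real (m n k) / real n) / real (m n k)"
      by (intro divide_right_mono) auto
    then show ?thesis using m[of n] by simp
  qed (simp add: l_def)
  have "\<exists>enc dec. classical_scheme K nx ny n (m' n) enc dec \<and>
      (\<forall>i<K. classical_err K nx ny W n (m' n) enc dec i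
        \<le> ns_err K nx ny W n (m n) (Z n) k + (real (l n) - 1) / real (m n k))" for n
    unfolding m'_def by (rule ns_to_classical[OF ns k l1])
  then obtain enc dec where sch: "\<And>n. classical_scheme K nx ny n (m' n) (enc n) (dec n)"
    and err: "\<And>n i. i < K \<Longrightarrow> classical_err K nx ny W n (m' n) (enc n) (dec n) i
        \<le> ns_err K nx ny W n (m n) (Z n) k + (real (l n) - 1) / real (m n k)" by metis
  let ?ns = "\<lambda>n. Max ((\<lambda>k. ns_err K nx ny W n (m n) (Z n) k) ` {..<K})"
  let ?c = "\<lambda>n. Max ((\<lambda>i. classical_err K nx ny W n (m' n) (enc n) (dec n) i) ` {..<K})"
  have "?c \<longlonglongrightarrow> 0"
  proof (rule tendsto_sandwich)
    show "(\<lambda>_. 0) \<longlonglongrightarrow> (0::real)" by simp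
    have "(\<lambda>n. ?ns n + 1 / real n) \<longlonglongrightarrow> 0 + 0"
      by (intro tendsto_add lim lim_const_over_n)
    then show "(\<lambda>n. ?ns n + 1 / real n) \<longlonglongrightarrow> 0" by simp
    have "0 \<le> ?c n" for n
    proof -
      have "0 \<le> classical_err K nx ny W n (m' n) (enc n) (dec n) k"
        by (rule classical_err_nonneg[OF sch k])
      also have "\<dots> \<le> ?c n" using k by (intro Max_ge) auto
      finally show ?thesis .
    qed
    then show "\<forall>\<^sub>F n in sequentially. 0 \<le> ?c n" by simp
    have "?c n \<le> ?ns n + 1 / real n" for n
    proof (rule Max.boundedI)
      show "(\<lambda>i. classical_err K nx ny W n (m' n) (enc n) (dec n) i) ` {..<K} \<noteq> {}" using k by auto
      fix a assume "a \<in> (\<lambda>i. classical_err K nx ny W n (m' n) (enc n) (dec n) i) ` {..<K}"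
      then obtain i where i: "i < K" "a = classical_err K nx ny W n (m' n) (enc n) (dec n) i" by auto
      have "ns_err K nx ny W n (m n) (Z n) k \<le> ?ns n" using k by (intro Max_ge) auto
      then show "a \<le> ?ns n + 1 / real n" using err[OF i(1), of n] lm[of n] i(2) by linarith
    qed simp
    then show "\<forall>\<^sub>F n in sequentially. ?c n \<le> ?ns n + 1 / real n" by simp
  qed
  moreover have "(\<lambda>n. log 2 (real (l n)) / real n) \<longlonglongrightarrow> L"
  proof (rule tendsto_sandwich)
    have "(\<lambda>n. log 2 (real (m n k)) / real n - (1 / real n + ln (real n) / real n / ln 2)) \<longlonglongrightarrow> L - (0 + 0 / ln 2)"
      by (intro tendsto_intros L(1) lim_const_over_n) auto
    then show "(\<lambda>n. log 2 (real (m n k)) / real n - (1 / real n + ln (real n) / real n / ln 2)) \<longlonglongrightarrow> L" by simp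
    show "\<forall>\<^sub>F n in sequentially. log 2 (real (m n k)) / real n - (1 / real n + ln (real n) / real n / ln 2)
        \<le> log 2 (real (l n)) / real n"
      using eventually_gt_at_top[of 0]
    proof eventually_elim
      case (elim n)
      \<comment> \<open>The remainder is below \<open>n\<close>, and quotient plus one is at most
        \<open>2 * l n\<close>, even for quotient 0.\<close>
      have "m n k < n * (m n k div n + 1)"
        using elim by (simp add: dividend_less_times_div)
      also have "\<dots> \<le> n * (2 * l n)" unfolding l_def by (intro mult_le_mono2) simp
      finally have "real (m n k) \<le> real (n * (2 * l n))" by linarith
      then have "log 2 (real (m n k)) \<le> log 2 (real (n * (2 * l n)))"
        using m[of n] l1[of n] elim by (subst log_le_cancel_iff) auto
      also have "\<dots> = ln (real n) / ln 2 + 1 + log 2 (real (l n))"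
        using l1[of n] elim by (simp add: log_mult) (simp add: log_def)
      finally have "log 2 (real (m n k)) / real n \<le> (ln (real n) / ln 2 + 1 + log 2 (real (l n))) / real n"
        by (intro divide_right_mono) auto
      then show ?case by (simp add: add_divide_distrib mult.commute)
    qed
    show "(\<lambda>n. log 2 (real (m n k)) / real n) \<longlonglongrightarrow> L" by (rule L(1))
    have "l n \<le> m n k" for n unfolding l_def using m[of n] div_le_dividend[of "m n k" n] by simp
    then show "\<forall>\<^sub>F n in sequentially. log 2 (real (l n)) / real n \<le> log 2 (real (m n k)) / real n"
      using l1 m by (intro always_eventually allI divide_right_mono) (auto simp: Suc_le_eq)
  qed
  then have "\<forall>i<K. \<exists>L. (\<lambda>n. log 2 (real (m' n i)) / real n) \<longlonglongrightarrow> L \<and> L \<ge> (if i = k then R k else 0)"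
    using L(2) unfolding m'_def by auto
  ultimately show ?thesis
    unfolding achievable_C_def using sch k by (intro conjI exI[of _ m'] exI[of _ enc] exI[of _ dec]) auto
qed

text \<open>One message per user and a constant input. This point keeps both capacity regions
  non-empty, as their suprema require.\<close>

lemma achievable_NS_0:
  assumes K: "K \<ge> 1"
  shows "achievable_NS K nx ny W (\<lambda>_. 0)"
proof -
  define x0 :: "nat \<Rightarrow> nat \<Rightarrow> nat" where "x0 n = (\<lambda>t\<in>{..<n}. 0)" for n
  have x0: "x0 n \<in> xblocks nx n" for n unfolding x0_def xblocks_def using nx by auto
  define Z :: "nat \<Rightarrow> (nat \<Rightarrow> nat) \<Rightarrow> (nat \<Rightarrow> nat \<Rightarrow> nat) \<Rightarrow> (nat \<Rightarrow> nat) \<Rightarrow> (nat \<Rightarrow> nat) \<Rightarrow> real"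
    where "Z n w yy x wh = (if x = x0 n then 1 else 0)" for n w yy x wh
  have "ns_scheme K nx ny n (\<lambda>_. 1) (Z n)" for n
    unfolding ns_scheme_def ns_marg_def Z_def
    using x0[of n] by (auto simp: card_xblocks card_msgs)
  moreover have "ns_err K nx ny W n (\<lambda>_. 1) (Z n) k = 0" if "k < K" for n k
    using that unfolding ns_err_def msgs_def by (auto intro!: sum.neutral simp: PiE_iff)
  then have "(\<lambda>k. ns_err K nx ny W n (\<lambda>_. 1) (Z n) k) ` {..<K} = {0}" for n
    using K by (subst image_constant[symmetric, of 0]) (auto intro!: image_cong)
  ultimately show ?thesis
    unfolding achievable_NS_def
    by (intro conjI exI[of _ "\<lambda>_ _. 1"] exI[of _ Z]) auto
qed

end

text \<open>A sum of finitely many coordinates is continuous in the product topology, so the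
  half-space is closed.\<close>

lemma sum_closure_le:
  fixes B :: real and S :: "(nat \<Rightarrow> real) set"
  assumes "\<And>R. R \<in> S \<Longrightarrow> (\<Sum>k<K. R k) \<le> B" and "R \<in> closure S"
  shows "(\<Sum>k<K. R k) \<le> B"
proof -
  have "closed {R :: nat \<Rightarrow> real. (\<Sum>k<K. R k) \<le> B}"
    by (intro closed_Collect_le continuous_intros) auto
  then have "closure S \<subseteq> {R. (\<Sum>k<K. R k) \<le> B}"
    using assms(1) by (intro closure_minimal) auto
  then show ?thesis using assms(2) by blast
qed

context dm_bc
begin

text \<open>The bound from \<open>achievable_C_le\<close> is essential: the supremum of an unbounded
  set of reals carries no information.\<close>

lemma achievable_C_le_sumcap:
  assumes R: "achievable_C K nx ny W R"
  shows "(\<Sum>k<K. R k) \<le> sumcap_C K nx ny W"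
proof -
  have "(\<Sum>k<K. R k) \<le> (\<Sum>k<K. log 2 (real (ny k)))" if "R \<in> cap_region_C K nx ny W" for R
  proof (rule sum_closure_le)
    show "R \<in> closure {R. achievable_C K nx ny W R}" using that unfolding cap_region_C_def .
  qed (use achievable_C_le in \<open>auto intro!: sum_mono\<close>)
  then have "bdd_above ((\<lambda>R. \<Sum>k<K. R k) ` cap_region_C K nx ny W)"
    by (intro bdd_aboveI) auto
  moreover have "R \<in> cap_region_C K nx ny W"
    using R unfolding cap_region_C_def by (intro closure_subset[THEN subsetD]) simp
  ultimately show ?thesis unfolding sumcap_C_def by (intro cSup_upper) auto
qed

text \<open>Each rate on its own is classically achievable with the other users silent;
  \<open>K\<close> such bounds add up to the factor \<open>K\<close>.\<close>

lemma achievable_NS_le: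
  assumes R: "achievable_NS K nx ny W R"
  shows "(\<Sum>k<K. R k) \<le> real K * sumcap_C K nx ny W"
proof -
  have "R k \<le> sumcap_C K nx ny W" if "k < K" for k
    using achievable_C_le_sumcap[OF single_user_achievable_C[OF R that]] that by simp
  then have "(\<Sum>k<K. R k) \<le> (\<Sum>k<K. sumcap_C K nx ny W)" by (intro sum_mono) auto
  then show ?thesis by simp
qed

lemma cap_region_NS_le: "R \<in> cap_region_NS K nx ny W \<Longrightarrow> (\<Sum>k<K. R k) \<le> real K * sumcap_C K nx ny W"
  unfolding cap_region_NS_def by (rule sum_closure_le[OF achievable_NS_le]) auto

lemma achievable_NS_le_sumcap:
  assumes R: "achievable_NS K nx ny W R"
  shows "(\<Sum>k<K. R k) \<le> sumcap_NS K nx ny W"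
proof -
  have "bdd_above ((\<lambda>R. \<Sum>k<K. R k) ` cap_region_NS K nx ny W)"
    using cap_region_NS_le by (intro bdd_aboveI) auto
  moreover have "R \<in> cap_region_NS K nx ny W"
    using R unfolding cap_region_NS_def by (intro closure_subset[THEN subsetD]) simp
  ultimately show ?thesis unfolding sumcap_NS_def by (intro cSup_upper) auto
qed

lemma sumcap_NS_le:
  assumes "K \<ge> 1"
  shows "sumcap_NS K nx ny W \<le> real K * sumcap_C K nx ny W"
  unfolding sumcap_NS_def
proof (rule cSup_least)
  show "(\<lambda>R. \<Sum>k<K. R k) ` cap_region_NS K nx ny W \<noteq> {}"
    using achievable_NS_0[OF assms] unfolding cap_region_NS_def closure_eq_empty image_is_empty by blast
  show "s \<le> real K * sumcap_C K nx ny W" if "s \<in> (\<lambda>R. \<Sum>k<K. R k) ` cap_region_NS K nx ny W" for s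
    using that cap_region_NS_le by blast
qed

lemma sumcap_C_le:
  assumes K: "K \<ge> 1" and B: "\<And>R. achievable_C K nx ny W R \<Longrightarrow> (\<Sum>k<K. R k) \<le> B"
  shows "sumcap_C K nx ny W \<le> B"
  unfolding sumcap_C_def
proof (rule cSup_least)
  \<comment> \<open>The zero tuple, obtained as the single-user part of the trivial non-signalling
    scheme, shows that the region is non-empty.\<close>
  have "achievable_C K nx ny W (\<lambda>i. if i = 0 then 0 else 0)"
    using single_user_achievable_C[OF achievable_NS_0[OF K], of 0] K by simp
  then show "(\<lambda>R. \<Sum>k<K. R k) ` cap_region_C K nx ny W \<noteq> {}"
    unfolding cap_region_C_def closure_eq_empty image_is_empty by blast
  show "s \<le> B" if "s \<in> (\<lambda>R. \<Sum>k<K. R k) ` cap_region_C K nx ny W" for s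
    using that sum_closure_le[OF B] unfolding cap_region_C_def by blast
qed

end

section \<open>The ratio for the Reed-Solomon channel and the supremum\<close>

context rs_bc
begin

interpretation bc: dm_bc K "p ^ K" ny W
  by unfold_locales (rule is_dm_bc)

lemma log_p_le_sumcap_NS: "real K * log 2 p \<le> sumcap_NS K (p ^ K) ny W"
  using bc.achievable_NS_le_sumcap[OF achievable_NS_log_p] by simp

text \<open>The upper bound read backwards: the non-signalling sum-capacity is positive and at most
  \<open>K\<close> times the classical one.\<close>

lemma sumcap_C_pos: "sumcap_C K (p ^ K) ny W > 0"
proof -
  have "0 < real K * log 2 p" using K prime_gt_1_nat[OF p] by simp
  also have "\<dots> \<le> sumcap_NS K (p ^ K) ny W" by (rule log_p_le_sumcap_NS)
  also have "\<dots> \<le> real K * sumcap_C K (p ^ K) ny W" by (rule bc.sumcap_NS_le[OF K])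
  finally show ?thesis by (simp add: zero_less_mult_iff)
qed

lemma sumcap_C_le_log_p: "sumcap_C K (p ^ K) ny W \<le> log 2 p + K * log 2 r"
  using bc.sumcap_C_le[OF K achievable_C_sum_le] .

lemma sumcap_ratio_ge:
  "real K * log 2 p / (log 2 p + K * log 2 r) \<le> sumcap_NS K (p ^ K) ny W / sumcap_C K (p ^ K) ny W"
proof (rule frac_le)
  have "0 < real K * log 2 p" using K prime_gt_1_nat[OF p] by simp
  then show "0 \<le> sumcap_NS K (p ^ K) ny W" using log_p_le_sumcap_NS by linarith
qed (fact log_p_le_sumcap_NS sumcap_C_pos sumcap_C_le_log_p)+

end

text \<open>With \<open>K * log 2 r \<le> c\<close>, the ratio exceeds \<open>b\<close> as soon as
  \<open>\<bar>b\<bar> * c < (K - b) * log 2 p\<close>, which fixes the threshold for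
  \<open>p\<close>; the absolute value covers negative \<open>b\<close>. Taking \<open>p > K\<close>
  as well makes \<open>N\<close> positive.\<close>

lemma ex_bc_ratio_gt:
  fixes b :: real
  assumes K: "K \<ge> 1" and b: "b < real K"
  shows "\<exists>nx ny W. is_dm_bc K nx ny W \<and> sumcap_C K nx ny W > 0 \<and>
    b < sumcap_NS K nx ny W / sumcap_C K nx ny W"
proof -
  \<comment> \<open>For \<open>N = p div K \<ge> 1\<close> one has
    \<open>p < K * (N + 1) \<le> 2 * K * N\<close>, hence \<open>r \<le> 1 + 2 * K ^ 2\<close>
    uniformly in \<open>p\<close>.\<close>
  define c where "c = K * log 2 (1 + 2 * real K ^ 2)"
  obtain p where p: "prime p" "p > max K (nat \<lceil>2 powr (\<bar>b\<bar> * c / (real K - b))\<rceil>)"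
    using bigger_prime by blast
  have "2 powr (\<bar>b\<bar> * c / (real K - b)) < real p" using p(2) by linarith
  then have lp: "\<bar>b\<bar> * c / (real K - b) < log 2 p"
    using p(1) prime_gt_0_nat by (subst less_log_iff) auto
  define N where "N = p div K"
  have N: "N \<ge> 1" using p(2) K unfolding N_def by (simp add: div_greater_zero_iff Suc_le_eq)
  interpret rs_bc p K N
    by unfold_locales (use p K N in \<open>auto simp: N_def\<close>)
  have "r \<le> 1 + 2 * real K ^ 2"
  proof -
    have "p < K * (N + 1)" unfolding N_def using K by (simp add: dividend_less_times_div)
    also have "\<dots> \<le> K * (2 * N)" using N by (intro mult_le_mono2) simp
    finally have "real p \<le> real (K * (2 * N))" by linarith
    then have "real p * real (K - 1) \<le> real (K * (2 * N)) * real K"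
      by (intro mult_mono) auto
    then have "real p * real (K - 1) / real N \<le> 2 * real K ^ 2"
      using N by (simp add: pos_divide_le_eq power2_eq_square mult_ac)
    then show ?thesis unfolding r_def by simp
  qed
  then have rc: "K * log 2 r \<le> c"
    unfolding c_def using r_ge_1 by (intro mult_left_mono) auto
  have r0: "K * log 2 r \<ge> 0" using r_ge_1 by simp
  have lp0: "log 2 p > 0" using prime_gt_1_nat[OF p(1)] by simp
  have "\<bar>b\<bar> * c < log 2 p * (real K - b)" using lp b by (simp add: pos_divide_less_eq)
  moreover have "b * (K * log 2 r) \<le> \<bar>b\<bar> * c"
    using rc r0 by (intro mult_mono) auto
  ultimately have "b * (log 2 p + K * log 2 r) < real K * log 2 p"
    by (simp add: algebra_simps)
  then have "b < real K * log 2 p / (log 2 p + K * log 2 r)"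
    using lp0 r0 by (subst pos_less_divide_eq) auto
  also note sumcap_ratio_ge
  finally show ?thesis using is_dm_bc sumcap_C_pos by blast
qed

theorem theorem7:
  fixes K :: nat
  assumes "K \<ge> 1"
  shows "(SUP (nx, ny, W) \<in> {(nx, ny, W). is_dm_bc K nx ny W \<and> sumcap_C K nx ny W > 0}.
            ereal (sumcap_NS K nx ny W / sumcap_C K nx ny W)) = ereal (real K)"
proof (rule antisym)
  show "(SUP (nx, ny, W) \<in> {(nx, ny, W). is_dm_bc K nx ny W \<and> sumcap_C K nx ny W > 0}.
            ereal (sumcap_NS K nx ny W / sumcap_C K nx ny W)) \<le> ereal (real K)"
  proof (rule SUP_least, clarify)
    fix nx ny W assume W: "is_dm_bc K nx ny W" "sumcap_C K nx ny W > 0"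
    interpret dm_bc K nx ny W by unfold_locales (rule W)
    show "ereal (sumcap_NS K nx ny W / sumcap_C K nx ny W) \<le> ereal (real K)"
      using sumcap_NS_le[OF assms] W(2) by (simp add: pos_divide_le_eq)
  qed
  show "ereal (real K) \<le> (SUP (nx, ny, W) \<in> {(nx, ny, W). is_dm_bc K nx ny W \<and> sumcap_C K nx ny W > 0}.
            ereal (sumcap_NS K nx ny W / sumcap_C K nx ny W))"
  proof (rule dense_le)
    fix a assume "a < ereal (real K)"
    then obtain b where b: "a < ereal b" "b < real K"
      using ereal_dense2[of a "ereal (real K)"] by auto
    obtain nx ny W where W: "is_dm_bc K nx ny W" "sumcap_C K nx ny W > 0"
      "b < sumcap_NS K nx ny W / sumcap_C K nx ny W"
      using ex_bc_ratio_gt[OF assms b(2)] by blast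
    have "a \<le> ereal (sumcap_NS K nx ny W / sumcap_C K nx ny W)"
      using b(1) W(3) by (meson less_ereal.simps(1) less_imp_le less_trans)
    then show "a \<le> (SUP (nx, ny, W) \<in> {(nx, ny, W). is_dm_bc K nx ny W \<and> sumcap_C K nx ny W > 0}.
            ereal (sumcap_NS K nx ny W / sumcap_C K nx ny W))"
      using W(1,2) by (intro SUP_upper2[of "(nx, ny, W)"]) auto
  qed
qed

end
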